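(* Let $X$ be a sequentially complete locally convex space and $\mathcal{P}$ a calibration on $X$. If $T,S\in (Q_{\mathcal{P}}(X))_{0}$ are quasi-nilpotent equivalent operators and $T$ has the single-valued extension property (SVEP), then $\sigma_{T}(x)=\sigma_{S}(x)$ for every $x\in X$.
   Context: Locally convex spaces are complex and Hausdorff. A calibration on $X$ is a family $\mathcal{P}$ of seminorms generating the topology of $X$. $Q_{\mathcal{P}}(X)$ is the algebra of linear operators $T:X\to X$ such that for every $p\in\mathcal{P}$ there is $c_p>0$ with $p(Tx)\le c_p\,p(x)$ for all $x\in X$ (quotient bounded operators). For $p\in\mathcal{P}$ and $T\in Q_{\mathcal{P}}(X)$ put $\hat p(T)=\inf\{r>0 : p(Tx)\le r\,p(x)\ \forall x\in X\}$; $Q_{\mathcal{P}}(X)$ carries the topology generated by the seminorms $\hat p$, $p\in\mathcal{P}$, and a subset of $Q_{\mathcal{P}}(X)$ is bounded if each $\hat p$ is bounded on it. $(Q_{\mathcal{P}}(X))_0$ is the set of bounded elements of $Q_{\mathcal{P}}(X)$ (in the sense of Allan): those $T\in Q_{\mathcal{P}}(X)$ for which there is $\alpha>0$ such that $\{(\alpha^{-1}T)^n : n\ge 1\}$ is bounded in $Q_{\mathcal{P}}(X)$. $T\in (Q_{\mathcal{P}}(X))_0$ has SVEP if for every open set $D_f\subset\mathbb{C}$ and every analytic function $f:D_f\to X$ with $(\lambda I-T)f(\lambda)=0$ for all $\lambda\in D_f$, one has $f(\lambda)=0$ for all $\lambda\in D_f$. For $T\in (Q_{\mathcal{P}}(X))_0$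 and $x\in X$, $\rho_T(x)$ is the set of all $\lambda_0\in\mathbb{C}$ for which there exist an open set $D_{\lambda_0}\subset\mathbb{C}$ containing $\lambda_0$ and an analytic function $f_x:D_{\lambda_0}\to X$ with $(\lambda I-T)f_x(\lambda)=x$ for all $\lambda\in D_{\lambda_0}$; and $\sigma_T(x)=\mathbb{C}\setminus\rho_T(x)$. For $T,S\in (Q_{\mathcal{P}}(X))_0$ (not necessarily commuting) and $n\ge 0$, $(T-S)^{[n]}=\sum_{k=0}^{n}(-1)^{n-k}\binom{n}{k}T^kS^{n-k}$. $T$ and $S$ are quasi-nilpotent equivalent if for every $p\in\mathcal{P}$, $\lim_{n\to\infty}\hat p((T-S)^{[n]})^{1/n}=0$ and $\lim_{n\to\infty}\hat p((S-T)^{[n]})^{1/n}=0$. *)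

theory Defs
  imports Complex_Main
begin

text \<open>Addition is continuous and the topology is Hausdorff by the sort of \<open>'a\<close>. Complex
  scalars are not covered by a type class, so the scalar multiplication is an explicit parameter.\<close>

locale locally_convex_space = vector_space scale
  for scale :: "complex \<Rightarrow> 'a::{topological_ab_group_add, t2_space} \<Rightarrow> 'a" +
  assumes continuous_scale: "continuous_on UNIV (\<lambda>(c, x). scale c x)"
    and convex_base: "\<And>U. open U \<Longrightarrow> 0 \<in> U \<Longrightarrow>
      \<exists>V. open V \<and> 0 \<in> V \<and> V \<subseteq> U \<and>
        (\<forall>x\<in>V. \<forall>y\<in>V. \<forall>t::real. 0 \<le> t \<and> t \<le> 1 \<longrightarrow>
          scale (of_real (1 - t)) x + scale (of_real t) y \<in> V)"

text \<open>Cauchy sequences with respect to the uniformity of the topological group.\<close>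

definition sequentially_complete :: "'a::topological_ab_group_add itself \<Rightarrow> bool" where
  "sequentially_complete _ \<longleftrightarrow>
    (\<forall>u :: nat \<Rightarrow> 'a.
      (\<forall>U. open U \<and> 0 \<in> U \<longrightarrow> (\<exists>N. \<forall>m\<ge>N. \<forall>n\<ge>N. u m - u n \<in> U)) \<longrightarrow> convergent u)"

definition seminorm :: "(complex \<Rightarrow> 'a::ab_group_add \<Rightarrow> 'a) \<Rightarrow> ('a \<Rightarrow> real) \<Rightarrow> bool" where
  "seminorm scale p \<longleftrightarrow>
    (\<forall>x. 0 \<le> p x) \<and> (\<forall>x y. p (x + y) \<le> p x + p y) \<and> (\<forall>c x. p (scale c x) = cmod c * p x)"

definition calibration ::
  "(complex \<Rightarrow> 'a::topological_ab_group_add \<Rightarrow> 'a) \<Rightarrow> ('a \<Rightarrow> real) set \<Rightarrow> bool" where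
  "calibration scale P \<longleftrightarrow>
    (\<forall>p\<in>P. seminorm scale p) \<and>
    (open = generate_topology {{y. p (y - x) < r} | p x r. p \<in> P \<and> r > 0})"

definition quotient_bounded ::
  "(complex \<Rightarrow> 'a::ab_group_add \<Rightarrow> 'a) \<Rightarrow> ('a \<Rightarrow> real) set \<Rightarrow> ('a \<Rightarrow> 'a) set" where
  "quotient_bounded scale P =
    {T. Vector_Spaces.linear scale scale T \<and> (\<forall>p\<in>P. \<exists>c>0. \<forall>x. p (T x) \<le> c * p x)}"

definition op_seminorm :: "('a \<Rightarrow> real) \<Rightarrow> ('a \<Rightarrow> 'a) \<Rightarrow> real" where
  "op_seminorm p T = Inf {r. r > 0 \<and> (\<forall>x. p (T x) \<le> r * p x)}"

definition bounded_in_quotient_bounded ::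
  "(complex \<Rightarrow> 'a::ab_group_add \<Rightarrow> 'a) \<Rightarrow> ('a \<Rightarrow> real) set \<Rightarrow> ('a \<Rightarrow> 'a) set \<Rightarrow> bool" where
  "bounded_in_quotient_bounded scale P B \<longleftrightarrow>
    B \<subseteq> quotient_bounded scale P \<and> (\<forall>p\<in>P. bdd_above (op_seminorm p ` B))"

definition bounded_elements ::
  "(complex \<Rightarrow> 'a::ab_group_add \<Rightarrow> 'a) \<Rightarrow> ('a \<Rightarrow> real) set \<Rightarrow> ('a \<Rightarrow> 'a) set" where
  "bounded_elements scale P =
    {T \<in> quotient_bounded scale P. \<exists>\<alpha>::real. \<alpha> > 0 \<and>
      bounded_in_quotient_bounded scale P
        {(\<lambda>x. scale (of_real (inverse \<alpha>)) (T x)) ^^ n | n. n \<ge> 1}}"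

text \<open>Analyticity on an open set is complex differentiability at each of its points, as for
  \<open>analytic_on\<close> in the scalar case.\<close>

definition lc_analytic_on ::
  "(complex \<Rightarrow> 'a::topological_ab_group_add \<Rightarrow> 'a) \<Rightarrow> (complex \<Rightarrow> 'a) \<Rightarrow> complex set \<Rightarrow> bool" where
  "lc_analytic_on scale f D \<longleftrightarrow>
    (\<forall>z\<in>D. \<exists>d. ((\<lambda>w. scale (inverse (w - z)) (f w - f z)) \<longlongrightarrow> d) (at z))"

definition SVEP ::
  "(complex \<Rightarrow> 'a::topological_ab_group_add \<Rightarrow> 'a) \<Rightarrow> ('a \<Rightarrow> 'a) \<Rightarrow> bool" where
  "SVEP scale T \<longleftrightarrow>
    (\<forall>D f. open D \<and> lc_analytic_on scale f D \<and> (\<forall>l\<in>D. scale l (f l) - T (f l) = 0)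
      \<longrightarrow> (\<forall>l\<in>D. f l = 0))"

definition local_resolvent_set ::
  "(complex \<Rightarrow> 'a::topological_ab_group_add \<Rightarrow> 'a) \<Rightarrow> ('a \<Rightarrow> 'a) \<Rightarrow> 'a \<Rightarrow> complex set" where
  "local_resolvent_set scale T x =
    {l0. \<exists>D f. open D \<and> l0 \<in> D \<and> lc_analytic_on scale f D \<and>
      (\<forall>l\<in>D. scale l (f l) - T (f l) = x)}"

definition local_spectrum ::
  "(complex \<Rightarrow> 'a::topological_ab_group_add \<Rightarrow> 'a) \<Rightarrow> ('a \<Rightarrow> 'a) \<Rightarrow> 'a \<Rightarrow> complex set" where
  "local_spectrum scale T x = - local_resolvent_set scale T x"

text \<open>The operator \<open>(T - S)\<^sup>[\<^sup>n\<^sup>]\<close>, which is not a power of \<open>T - S\<close> unless \<open>T\<close> and \<open>S\<close> commute.\<close>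

definition bracket_power ::
  "(complex \<Rightarrow> 'a::ab_group_add \<Rightarrow> 'a) \<Rightarrow> ('a \<Rightarrow> 'a) \<Rightarrow> ('a \<Rightarrow> 'a) \<Rightarrow> nat \<Rightarrow> 'a \<Rightarrow> 'a" where
  "bracket_power scale T S n x =
    (\<Sum>k\<le>n. scale ((-1) ^ (n - k) * of_nat (n choose k)) ((T ^^ k) ((S ^^ (n - k)) x)))"

definition quasinilpotent_equivalent ::
  "(complex \<Rightarrow> 'a::ab_group_add \<Rightarrow> 'a) \<Rightarrow> ('a \<Rightarrow> real) set \<Rightarrow> ('a \<Rightarrow> 'a) \<Rightarrow> ('a \<Rightarrow> 'a) \<Rightarrow> bool" where
  "quasinilpotent_equivalent scale P T S \<longleftrightarrow>
    (\<forall>p\<in>P.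
      (\<lambda>n. root n (op_seminorm p (bracket_power scale T S n))) \<longlonglongrightarrow> 0 \<and>
      (\<lambda>n. root n (op_seminorm p (bracket_power scale S T n))) \<longlonglongrightarrow> 0)"

end

theory Submission
  imports Defs "HOL-Complex_Analysis.Cauchy_Integral_Formula"
begin

text \<open>A point \<open>l\<close> lies in the local resolvent set of \<open>T\<close> at \<open>x\<close> iff there is a sequence
  \<open>a\<^sub>0 = x\<close>, \<open>(l I - T) a\<^sub>k\<^sub>+\<^sub>1 = a\<^sub>k\<close> that grows at most geometrically, at a rate independent of
  the seminorm: given a local solution \<open>f\<close>, take \<open>a\<^sub>k\<^sub>+\<^sub>1\<close> to be \<open>(-1)\<^sup>k\<close> times its \<open>k\<close>-th Taylor
  coefficient at \<open>l\<close>; conversely, \<open>f(w) = \<Sum> (l - w)\<^sup>k a\<^sub>k\<^sub>+\<^sub>1\<close>. Such a sequence for \<open>T\<close> is turned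
  into one for \<open>S\<close> by the binomial series \<open>b\<^sub>m = \<Sum>\<^sub>n (n+m-1 choose n) (S - T)\<^sup>[\<^sup>n\<^sup>] a\<^sub>n\<^sub>+\<^sub>m\<close>, which
  converges by quasi-nilpotence and solves the recursion for \<open>S\<close> because
  \<open>(S - T)\<^sup>[\<^sup>n\<^sup>+\<^sup>1\<^sup>] = S (S - T)\<^sup>[\<^sup>n\<^sup>] - (S - T)\<^sup>[\<^sup>n\<^sup>] T\<close>.

  The Taylor coefficients exist in \<open>X\<close> although only sequential completeness is assumed: averages of
  \<open>f(w) (w - l)\<^sup>-\<^sup>k\<close> over the \<open>N\<close>-th roots of unity on a circle around \<open>l\<close> form a Cauchy sequence.
  For scalar functions this follows from the power series, at a rate depending only on a bound for the
  function, and the Hahn--Banach theorem for one seminorm transfers the estimate to \<open>X\<close>.\<close>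

section \<open>Sublinear functionals\<close>

text \<open>The inequality in the second conjunct already forces equality, see \<open>sublinear_scale\<close>.\<close>

definition sublinear :: "(complex \<Rightarrow> 'a::ab_group_add \<Rightarrow> 'a) \<Rightarrow> ('a \<Rightarrow> real) \<Rightarrow> bool" where
  "sublinear sc q \<longleftrightarrow> (\<forall>x y. q (x + y) \<le> q x + q y) \<and>
    (\<forall>t x. 0 \<le> t \<longrightarrow> q (sc (of_real t) x) \<le> t * q x)"

lemma sublinear_add: "sublinear sc q \<Longrightarrow> q (x + y) \<le> q x + q y"
  by (simp add: sublinear_def)

locale complex_vector_space = vector_space scale
  for scale :: "complex \<Rightarrow> 'a::ab_group_add \<Rightarrow> 'a"
begin

lemma sublinear_zero:
  assumes "sublinear scale q"
  shows "q 0 = 0"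
proof -
  have "q (scale (of_real 0) 0) \<le> 0 * q 0"
    using assms unfolding sublinear_def by blast
  moreover have "q (0 + 0) \<le> q 0 + q 0"
    using assms by (rule sublinear_add)
  ultimately show ?thesis by simp
qed

lemma sublinear_scale:
  assumes "sublinear scale q" "0 \<le> t"
  shows "q (scale (of_real t) x) = t * q x"
proof (cases "t = 0")
  case True
  then show ?thesis using sublinear_zero[OF assms(1)] by simp
next
  case False
  with assms have t: "t > 0" by simp
  have "q x = q (scale (of_real (inverse t)) (scale (of_real t) x))"
    using t by simp
  also have "\<dots> \<le> inverse t * q (scale (of_real t) x)"
    using assms t unfolding sublinear_def by (meson inverse_nonnegative_iff_nonnegative)
  finally have "t * q x \<le> q (scale (of_real t) x)"
    using t by (simp add: field_simps)
  moreover have "q (scale (of_real t) x) \<le> t * q x"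
    using assms unfolding sublinear_def by blast
  ultimately show ?thesis by simp
qed

lemma sublinear_minus:
  assumes "sublinear scale q"
  shows "- q (- x) \<le> q x"
  using sublinear_add[OF assms, of x "- x"] sublinear_zero[OF assms] by simp

text \<open>For sublinear \<open>q\<close> this is the largest sublinear functional below
  \<open>q\<close> whose value at \<open>- y\<close> is at most \<open>- q y\<close>. It serves
  twice: to show that a minimal functional is odd, and to prescribe the value at one vector in
  \<open>Hahn_Banach_seminorm\<close>.\<close>

definition tilt :: "('a \<Rightarrow> real) \<Rightarrow> 'a \<Rightarrow> 'a \<Rightarrow> real" where
  "tilt q y x = (INF t\<in>{0..}. q (x + scale (of_real t) y) - t * q y)"

lemma tilt_bdd_below:
  assumes "sublinear scale q"
  shows "bdd_below ((\<lambda>t. q (x + scale (of_real t) y) - t * q y) ` {0..})"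
proof (rule bdd_belowI2)
  fix t :: real assume "t \<in> {0..}"
  then have "t * q y = q (scale (of_real t) y)"
    using sublinear_scale[OF assms] by simp
  also have "\<dots> \<le> q (x + scale (of_real t) y) + q (- x)"
    using sublinear_add[OF assms, of "x + scale (of_real t) y" "- x"] by simp
  finally show "- q (- x) \<le> q (x + scale (of_real t) y) - t * q y" by simp
qed

lemma tilt_le:
  assumes "sublinear scale q" "0 \<le> t"
  shows "tilt q y x \<le> q (x + scale (of_real t) y) - t * q y"
  unfolding tilt_def using assms by (intro cINF_lower tilt_bdd_below) auto

lemma tilt_ge:
  assumes "\<And>t. 0 \<le> t \<Longrightarrow> c \<le> q (x + scale (of_real t) y) - t * q y"
  shows "c \<le> tilt q y x"
  unfolding tilt_def using assms by (intro cINF_greatest) auto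

lemma tilt_le_self: "sublinear scale q \<Longrightarrow> tilt q y \<le> q"
  using tilt_le[of q 0 y] by (auto simp: le_fun_def)

lemma tilt_minus: "sublinear scale q \<Longrightarrow> tilt q y (- y) \<le> - q y"
  using tilt_le[of q 1 y "- y"] sublinear_zero[of q] by simp

text \<open>Parameters add up: \<open>s\<close> for \<open>x\<close> and \<open>t\<close> for
  \<open>z\<close> give the candidate \<open>s + t\<close> for \<open>x + z\<close>, and the infimum
  is taken over one parameter at a time. For homogeneity, \<open>t * s\<close> replaces
  \<open>s\<close>.\<close>

lemma sublinear_tilt:
  assumes q: "sublinear scale q"
  shows "sublinear scale (tilt q y)"
  unfolding sublinear_def
proof (intro conjI allI impI)
  fix x z
  have "tilt q y (x + z) - (q (z + scale (of_real t) y) - t * q y)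
      \<le> q (x + scale (of_real s) y) - s * q y" if "0 \<le> s" "0 \<le> t" for s t
  proof -
    have "tilt q y (x + z) \<le> q (x + z + scale (of_real (s + t)) y) - (s + t) * q y"
      using q that by (intro tilt_le) auto
    also have "x + z + scale (of_real (s + t)) y
        = (x + scale (of_real s) y) + (z + scale (of_real t) y)"
      by (simp add: algebra_simps scale_left_distrib)
    also have "q \<dots> \<le> q (x + scale (of_real s) y) + q (z + scale (of_real t) y)"
      using q by (rule sublinear_add)
    finally show ?thesis by (simp add: algebra_simps)
  qed
  then have "tilt q y (x + z) - (q (z + scale (of_real t) y) - t * q y) \<le> tilt q y x"
    if "0 \<le> t" for t
    using that by (intro tilt_ge) auto
  then have "tilt q y (x + z) - tilt q y x \<le> tilt q y z"
    by (intro tilt_ge) (simp add: algebra_simps)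
  then show "tilt q y (x + z) \<le> tilt q y x + tilt q y z" by simp
next
  fix t :: real and x assume "0 \<le> t"
  show "tilt q y (scale (of_real t) x) \<le> t * tilt q y x"
  proof (cases "t = 0")
    case True
    then show ?thesis
      using tilt_le_self[OF q, of y] sublinear_zero[OF q] by (simp add: le_fun_def) metis
  next
    case False
    with \<open>0 \<le> t\<close> have t: "t > 0" by simp
    have "tilt q y (scale (of_real t) x) / t \<le> q (x + scale (of_real s) y) - s * q y"
      if s: "0 \<le> s" for s
    proof -
      have "tilt q y (scale (of_real t) x)
          \<le> q (scale (of_real t) x + scale (of_real (t * s)) y) - (t * s) * q y"
        using q s t by (intro tilt_le) auto
      also have "scale (of_real t) x + scale (of_real (t * s)) y
          = scale (of_real t) (x + scale (of_real s) y)"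
        by (simp add: scale_right_distrib)
      also have "q \<dots> = t * q (x + scale (of_real s) y)"
        using q t by (intro sublinear_scale) auto
      finally show ?thesis using t by (simp add: field_simps)
    qed
    then have "tilt q y (scale (of_real t) x) / t \<le> tilt q y x"
      by (rule tilt_ge)
    then show ?thesis using t by (simp add: field_simps)
  qed
qed

section \<open>Minimal sublinear functionals and the Hahn-Banach theorem\<close>

text \<open>The pointwise infimum works. It is finite because every member lies below
  \<open>p\<close> and hence, at \<open>x\<close>, above \<open>- p (- x)\<close>. Subadditivity is
  where the chain enters: \<open>q x + r y\<close> is at least \<open>s x + s y\<close> for the
  smaller \<open>s\<close> of \<open>q\<close> and \<open>r\<close>.\<close>

lemma sublinear_chain_lower_bound:
  assumes C: "C \<noteq> {}" "\<And>q. q \<in> C \<Longrightarrow> sublinear scale q \<and> q \<le> p"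
    and chain: "\<And>q r. q \<in> C \<Longrightarrow> r \<in> C \<Longrightarrow> q \<le> r \<or> r \<le> q"
  shows "\<exists>u. sublinear scale u \<and> u \<le> p \<and> (\<forall>q\<in>C. u \<le> q)"
proof -
  define u where "u x = (INF q\<in>C. q x)" for x
  have bdd: "bdd_below ((\<lambda>q. q x) ` C)" for x
  proof (rule bdd_belowI2)
    fix q assume "q \<in> C"
    with C have "sublinear scale q" "q (- x) \<le> p (- x)" by (auto simp: le_fun_def)
    with sublinear_minus[of q x] show "- p (- x) \<le> q x" by simp
  qed
  have u_le: "u x \<le> q x" if "q \<in> C" for q x
    unfolding u_def using that bdd by (intro cINF_lower)
  have u_ge: "c \<le> u x" if "\<And>q. q \<in> C \<Longrightarrow> c \<le> q x" for c x
    unfolding u_def using that C(1) by (intro cINF_greatest)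
  have "sublinear scale u"
    unfolding sublinear_def
  proof (intro conjI allI impI)
    fix x y
    have "u (x + y) - r y \<le> q x" if qr: "q \<in> C" "r \<in> C" for q r
    proof -
      obtain s where s: "s \<in> C" "s \<le> q" "s \<le> r"
        using chain[OF qr] qr by auto
      have "u (x + y) \<le> s (x + y)" using s u_le by blast
      also have "\<dots> \<le> s x + s y" using C(2) s by (intro sublinear_add) auto
      also have "\<dots> \<le> q x + r y" using s by (intro add_mono) (auto simp: le_fun_def)
      finally show ?thesis by simp
    qed
    then have "u (x + y) - r y \<le> u x" if "r \<in> C" for r
      using that by (intro u_ge)
    then have "u (x + y) - u x \<le> u y"
      by (intro u_ge) (simp add: algebra_simps)
    then show "u (x + y) \<le> u x + u y" by simp
  next
    fix t :: real and x assume t: "0 \<le> t"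
    show "u (scale (of_real t) x) \<le> t * u x"
    proof (cases "t = 0")
      case True
      then show ?thesis
        using C u_le[of _ 0] sublinear_zero by fastforce
    next
      case False
      with t have t: "t > 0" by simp
      have "u (scale (of_real t) x) / t \<le> q x" if "q \<in> C" for q
      proof -
        have "u (scale (of_real t) x) \<le> q (scale (of_real t) x)"
          using that by (rule u_le)
        also have "\<dots> = t * q x"
          using C(2)[OF that] t by (intro sublinear_scale) auto
        finally show ?thesis using t by (simp add: field_simps)
      qed
      then have "u (scale (of_real t) x) / t \<le> u x" by (rule u_ge)
      then show ?thesis using t by (simp add: field_simps)
    qed
  qed
  moreover have "u \<le> p"
    using C u_le by (fastforce simp: le_fun_def intro: order_trans)
  ultimately show ?thesis using u_le by (auto simp: le_fun_def)
qed

text \<open>A minimal sublinear functional \<open>u\<close> coincides with each of its tilts, and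
  \<open>tilt_minus\<close> then says \<open>u (- y) \<le> - u y\<close>.\<close>

lemma minimal_sublinear_additive:
  assumes p: "sublinear scale p"
  obtains u where "sublinear scale u" "u \<le> p" "\<And>y. u (- y) = - u y"
proof -
  define A where "A = {q. sublinear scale q \<and> q \<le> p}"
  \<comment> \<open>The order is reversed, so that the maximal element from Zorn's lemma is minimal
    in the pointwise order.\<close>
  have po: "partial_order_on A (relation_of (\<lambda>a b. b \<le> a) A)"
    by (rule partial_order_on_relation_ofI) auto
  have "\<exists>u\<in>A. \<forall>q\<in>C. u \<le> q" if C: "C \<in> Chains (relation_of (\<lambda>a b. b \<le> a) A)" for C
  proof (cases "C = {}")
    case True
    then show ?thesis using p unfolding A_def by auto
  next
    case False
    have "\<exists>u. sublinear scale u \<and> u \<le> p \<and> (\<forall>q\<in>C. u \<le> q)"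
      using False C Chains_relation_of[OF C]
      by (intro sublinear_chain_lower_bound) (auto simp: A_def Chains_def relation_of_def)
    then show ?thesis unfolding A_def by auto
  qed
  from predicate_Zorn[OF po this]
  obtain u where u: "u \<in> A" and min: "\<And>q. q \<in> A \<Longrightarrow> q \<le> u \<Longrightarrow> q = u" by blast
  have sub: "sublinear scale u" "u \<le> p" using u unfolding A_def by auto
  have "u (- y) = - u y" for y
  proof -
    have "tilt u y = u"
      using sub sublinear_tilt[of u y] tilt_le_self[of u y]
      by (intro min) (auto simp: A_def)
    with tilt_minus[of u y] sub have "u (- y) \<le> - u y" by simp
    with sublinear_minus[OF sub(1), of y] show ?thesis by simp
  qed
  with sub that show ?thesis by blast
qed

lemma seminorm_sublinear: "seminorm scale p \<Longrightarrow> sublinear scale p"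
  by (simp add: seminorm_def sublinear_def)

text \<open>An odd sublinear \<open>u\<close> is taken below \<open>tilt p a\<close> instead of
  \<open>p\<close>; this gives \<open>u (- a) \<le> - p a\<close> and hence
  \<open>p a \<le> u a\<close>. Being sublinear and odd, \<open>u\<close> is real linear, and u x -
  i u (i x) is its complexification. Bounding the real and imaginary parts separately costs the
  factor 2.\<close>

theorem Hahn_Banach_seminorm:
  assumes p: "seminorm scale p"
  obtains \<phi> :: "'a \<Rightarrow> complex"
  where "\<And>x y. \<phi> (x + y) = \<phi> x + \<phi> y" "\<And>c x. \<phi> (scale c x) = c * \<phi> x"
    "\<And>x. cmod (\<phi> x) \<le> 2 * p x" "p a \<le> Re (\<phi> a)"
proof -
  have p': "sublinear scale p" using p by (rule seminorm_sublinear)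
  obtain u where u: "sublinear scale u" "u \<le> tilt p a" and u_minus: "\<And>y. u (- y) = - u y"
    using minimal_sublinear_additive[OF sublinear_tilt[OF p']] by blast
  have u_le: "u x \<le> p x" for x
    using u(2) tilt_le_self[OF p', of a] by (meson le_funD order_trans)
  have u_ge: "p a \<le> u a"
    using le_funD[OF u(2), of "- a"] tilt_minus[OF p', of a] u_minus[of a] by simp
  have u_add: "u (x + y) = u x + u y" for x y
  proof -
    have "u x \<le> u (x + y) + u (- y)" using sublinear_add[OF u(1), of "x + y" "- y"] by simp
    with sublinear_add[OF u(1), of x y] show ?thesis by (simp add: u_minus)
  qed
  have u_scale: "u (scale (of_real t) x) = t * u x" for t x
  proof (cases "0 \<le> t")
    case True
    then show ?thesis by (rule sublinear_scale[OF u(1)])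
  next
    case False
    then have "u (scale (of_real (- t)) x) = - t * u x"
      using sublinear_scale[OF u(1), of "- t"] by simp
    then show ?thesis by (simp add: u_minus)
  qed
  have u_abs: "\<bar>u x\<bar> \<le> p x" for x
  proof -
    have "p (- x) = p x"
      using p unfolding seminorm_def by (metis mult_1 norm_minus_cancel norm_one scale_minus_left scale_one)
    then show ?thesis using u_le[of x] u_le[of "- x"] u_minus[of x] by simp
  qed
  define \<phi> where "\<phi> x = Complex (u x) (- u (scale \<i> x))" for x
  show ?thesis
  proof
    show "\<phi> (x + y) = \<phi> x + \<phi> y" for x y
      by (simp add: \<phi>_def complex_eq_iff u_add scale_right_distrib)
    show "\<phi> (scale c x) = c * \<phi> x" for c x
    proof -
      have "scale c x = scale (of_real (Re c)) x + scale (of_real (Im c)) (scale \<i> x)"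
        by (metis complex_eq mult.commute scale_left_distrib scale_scale)
      moreover have "scale \<i> (scale c x)
          = scale (of_real (Re c)) (scale \<i> x) + scale (of_real (- Im c)) x"
      proof -
        have "\<i> * c = of_real (Re c) * \<i> + of_real (- Im c)" by (simp add: complex_eq_iff)
        then show ?thesis by (simp only: scale_scale scale_left_distrib)
      qed
      ultimately show ?thesis
        by (simp only: \<phi>_def complex_eq_iff u_add u_scale) (simp add: algebra_simps)
    qed
    show "cmod (\<phi> x) \<le> 2 * p x" for x
    proof -
      have "cmod (\<phi> x) \<le> \<bar>u x\<bar> + \<bar>u (scale \<i> x)\<bar>"
        using cmod_le[of "\<phi> x"] by (simp add: \<phi>_def)
      moreover have "p (scale \<i> x) = p x" using p by (simp add: seminorm_def)
      ultimately show ?thesis using u_abs[of x] u_abs[of "scale \<i> x"] by simp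
    qed
    show "p a \<le> Re (\<phi> a)" using u_ge by (simp add: \<phi>_def)
  qed
qed

end

section \<open>Averages over roots of unity\<close>

definition root_of_unity :: "nat \<Rightarrow> nat \<Rightarrow> complex" where
  "root_of_unity N j = exp (2 * of_real pi * \<i> * of_nat j / of_nat N)"

lemma norm_root_of_unity [simp]: "cmod (root_of_unity N j) = 1"
  by (simp add: root_of_unity_def)

lemma root_of_unity_nonzero [simp]: "root_of_unity N j \<noteq> 0"
  by (simp add: root_of_unity_def)

lemma root_of_unity_power: "root_of_unity N j ^ n = root_of_unity N n ^ j"
  by (simp add: root_of_unity_def exp_of_nat_mult[symmetric] mult_ac)

text \<open>By \<open>root_of_unity_power\<close> the sum is geometric with ratio \<open>z\<close>.
  It is nonzero for every \<open>n\<close> congruent to \<open>k\<close> modulo \<open>N\<close>;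
  since \<open>k < N\<close>, the first such index after \<open>k\<close> is \<open>N + k\<close>,
  hence the bound on \<open>n\<close>.\<close>

lemma sum_root_of_unity_quotients:
  assumes "k < N" "n < N + k"
  shows "(\<Sum>j<N. root_of_unity N j ^ n / root_of_unity N j ^ k) = (if n = k then of_nat N else 0)"
proof (cases "n = k")
  case False
  define z where "z = root_of_unity N n / root_of_unity N k"
  have "n mod N \<noteq> k mod N"
  proof
    assume *: "n mod N = k mod N"
    then have "n mod N = k" using assms by simp
    then have "n = k + N * (n div N)" by (metis add.commute div_mult_mod_eq mult.commute)
    moreover from this False have "n div N \<noteq> 0" by (metis add_0_right mult_0_right)
    then have "N \<le> N * (n div N)" by simp
    ultimately show False using assms by linarith
  qed
  then have "z \<noteq> 1"
    using complex_root_unity_eq[of N n k] assms by (auto simp: z_def root_of_unity_def)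
  moreover have "z ^ N = 1"
    using assms complex_root_unity[of N] by (simp add: z_def root_of_unity_def power_divide)
  ultimately have "(\<Sum>j<N. z ^ j) = 0" by (simp add: geometric_sum)
  then show ?thesis
    using False by (simp add: z_def power_divide root_of_unity_power[of N _ n] root_of_unity_power[of N _ k])
qed simp

text \<open>Averaging picks out the \<open>k\<close>-th Taylor coefficient exactly from the terms
  below \<open>N + k\<close>, so the error is the averaged tail. Sampling at radius
  \<open>r / 2\<close>, while \<open>F\<close> is bounded on the disc of radius \<open>r\<close>,
  makes the tail geometric with ratio 1/2. The error depends on \<open>F\<close> only through
  \<open>B\<close>, hence is uniform over the functionals dominated by one seminorm.\<close>

lemma root_average_Taylor_coefficient:
  assumes F: "F holomorphic_on ball c r" "continuous_on (cball c r) F"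
    and B: "\<And>w. w \<in> cball c r \<Longrightarrow> cmod (F w) \<le> B" and r: "0 < r" and k: "k < N"
  defines "z \<equiv> \<lambda>j. of_real (r / 2) * root_of_unity N j"
  shows "cmod ((\<Sum>j<N. F (c + z j) / z j ^ k) / of_nat N - (deriv ^^ k) F c / fact k)
    \<le> 2 * B / (r ^ k * 2 ^ N)"
proof -
  define d where "d n = (deriv ^^ n) F c / fact n" for n
  have N: "N > 0" using k by simp
  have zn: "cmod (z j) = r / 2" for j using r by (simp add: z_def norm_mult)
  have d_bound: "cmod (d n) \<le> B / r ^ n" for n
  proof -
    have "cmod ((deriv ^^ n) F c) \<le> fact n * B / r ^ n"
      using F r by (rule Cauchy_inequality) (auto intro!: B simp: dist_norm)
    then show ?thesis by (simp add: d_def norm_divide field_simps)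
  qed
  define R where "R j = F (c + z j) - (\<Sum>n<N + k. d n * z j ^ n)" for j
  have R_bound: "cmod (R j) \<le> 2 * B * (1 / 2) ^ (N + k)" for j
  proof -
    have "(\<lambda>n. d n * (c + z j - c) ^ n) sums F (c + z j)"
      unfolding d_def using F(1) by (rule holomorphic_power_series) (use zn[of j] r in \<open>simp add: dist_norm\<close>)
    then have "(\<lambda>n. d n * z j ^ n) sums F (c + z j)" by simp
    then have R: "(\<lambda>n. d (n + (N + k)) * z j ^ (n + (N + k))) sums R j"
      unfolding R_def using sums_iff_shift[of "\<lambda>n. d n * z j ^ n" "N + k"] by simp
    have le: "cmod (d n * z j ^ n) \<le> B * (1 / 2) ^ n" for n
    proof -
      have "cmod (d n * z j ^ n) = cmod (d n) * (r / 2) ^ n"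
        by (simp add: norm_mult norm_power zn)
      also have "\<dots> \<le> B / r ^ n * (r / 2) ^ n"
        using d_bound r by (intro mult_right_mono) auto
      also have "\<dots> = B * (1 / 2) ^ n" using r by (simp add: field_simps)
      finally show ?thesis .
    qed
    have geo: "(\<lambda>n. B * (1 / 2) ^ (N + k) * (1 / 2) ^ n) sums (B * (1 / 2) ^ (N + k) * 2)"
      using geometric_sums[of "1 / 2 :: real"] by (intro sums_mult) simp
    have "cmod (R j) \<le> (\<Sum>n. B * (1 / 2) ^ (N + k) * (1 / 2) ^ n)"
      unfolding sums_unique[OF R] using sums_summable[OF geo]
      by (rule norm_suminf_le[rotated]) (use le[of "_ + (N + k)"] in \<open>simp add: power_add mult_ac\<close>)
    also have "\<dots> = 2 * B * (1 / 2) ^ (N + k)" using sums_unique[OF geo] by simp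
    finally show ?thesis .
  qed
  have "(\<Sum>j<N. (\<Sum>n<N + k. d n * z j ^ n) / z j ^ k)
      = (\<Sum>n<N + k. \<Sum>j<N. d n * z j ^ n / z j ^ k)"
    by (subst sum.swap) (simp add: sum_divide_distrib)
  also have "\<dots> = (\<Sum>n<N + k. if n = k then of_nat N * d k else 0)"
  proof (rule sum.cong)
    fix n assume n: "n \<in> {..<N + k}"
    have "(\<Sum>j<N. d n * z j ^ n / z j ^ k)
        = d n * of_real (r / 2) ^ n / of_real (r / 2) ^ k
          * (\<Sum>j<N. root_of_unity N j ^ n / root_of_unity N j ^ k)"
      unfolding z_def power_mult_distrib sum_distrib_left by (intro sum.cong) simp_all
    also have "\<dots> = (if n = k then of_nat N * d k else 0)"
      using n r by (subst sum_root_of_unity_quotients) (auto simp: k)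
    finally show "(\<Sum>j<N. d n * z j ^ n / z j ^ k) = (if n = k then of_nat N * d k else 0)" .
  qed simp
  also have "\<dots> = of_nat N * d k" using N by simp
  finally have "(\<Sum>j<N. F (c + z j) / z j ^ k) = of_nat N * d k + (\<Sum>j<N. R j / z j ^ k)"
    by (simp add: R_def diff_divide_distrib sum_subtractf)
  then have "(\<Sum>j<N. F (c + z j) / z j ^ k) / of_nat N - d k = (\<Sum>j<N. R j / z j ^ k) / of_nat N"
    using N by (simp add: field_simps)
  \<comment> \<open>Dividing by \<open>z j ^ k\<close> costs \<open>(2 / r) ^ k\<close>, whose
    \<open>2 ^ k\<close> cancels against \<open>(1 / 2) ^ (N + k)\<close>.\<close>
  also have "cmod \<dots> \<le> (\<Sum>j<N. 2 * B * (1 / 2) ^ (N + k) / (r / 2) ^ k) / of_nat N"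
    unfolding norm_divide norm_of_nat
    by (intro divide_right_mono sum_norm_le) (use R_bound r in \<open>auto simp: norm_divide norm_power zn intro!: divide_right_mono\<close>)
  also have "\<dots> = 2 * B / (r ^ k * 2 ^ N)"
    using N r by (simp add: field_simps power_add)
  finally show ?thesis by (simp add: d_def)
qed

section \<open>Sequentially complete calibrated spaces\<close>

lemma sums_add_group:
  fixes f g :: "nat \<Rightarrow> 'a::topological_ab_group_add"
  shows "f sums a \<Longrightarrow> g sums b \<Longrightarrow> (\<lambda>n. f n + g n) sums (a + b)"
  unfolding sums_def by (simp add: sum.distrib tendsto_add)

lemma sums_diff_group:
  fixes f g :: "nat \<Rightarrow> 'a::topological_ab_group_add"
  shows "f sums a \<Longrightarrow> g sums b \<Longrightarrow> (\<lambda>n. f n - g n) sums (a - b)"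
  unfolding sums_def by (simp add: sum_subtractf tendsto_diff)

lemma telescope_sums_group:
  fixes v :: "nat \<Rightarrow> 'a::topological_ab_group_add"
  shows "v \<longlonglongrightarrow> 0 \<Longrightarrow> (\<lambda>n. v n - v (Suc n)) sums v 0"
  unfolding sums_def sum_lessThan_telescope' using tendsto_diff[of "\<lambda>_. v 0"] by fastforce

text \<open>The error in differentiating a power series termwise, weighted by the growth
  \<open>M ^ n\<close> of its coefficients. The radius \<open>1 / (8 * M)\<close> supplies
  \<open>8 ^ n\<close> in the denominator; the factor \<open>n * (n - 1)\<close> consumes at most
  \<open>4 ^ n\<close>, which leaves \<open>(1 / 2) ^ n\<close>. The exponent is
  \<open>n - 2\<close> rather than \<open>n\<close>, whence \<open>64 * M\<^sup>2\<close>. For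
  \<open>n < 2\<close> the error is zero.\<close>

lemma power_difference_quotient_bound:
  fixes z w :: complex
  assumes "M > 0" "cmod z \<le> 1 / (8 * M)" "cmod w \<le> 1 / (8 * M)" "w \<noteq> z"
  shows "cmod ((w ^ n - z ^ n) / (w - z) - of_nat n * z ^ (n - 1)) * M ^ n
    \<le> 64 * M\<^sup>2 * cmod (w - z) * (1 / 2) ^ n"
proof (cases "n < 2")
  case True
  then have "n = 0 \<or> n = 1" by auto
  then show ?thesis using assms by auto
next
  case False
  then obtain m where m: "n = m + 2" by (metis add.commute le_Suc_ex not_less)
  have "cmod ((w ^ n - z ^ n) / (w - z) - of_nat n * z ^ (n - 1))
      \<le> of_nat n * of_nat (n - Suc 0) * (1 / (8 * M)) ^ (n - 2) * cmod (w - z)"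
    using lemma_termdiff3[of "w - z" z "1 / (8 * M)" n] assms by simp
  also have "\<dots> \<le> 2 ^ n * 2 ^ n * (1 / (8 * M)) ^ (n - 2) * cmod (w - z)"
  proof -
    have "real n \<le> 2 ^ n" using of_nat_less_two_power[of n, where 'a = real] by simp
    moreover have "real (n - Suc 0) \<le> real n" by simp
    ultimately have "real n \<le> 2 ^ n" "real (n - Suc 0) \<le> 2 ^ n" by linarith+
    then show ?thesis using assms(1) by (intro mult_right_mono mult_mono) auto
  qed
  finally have "cmod ((w ^ n - z ^ n) / (w - z) - of_nat n * z ^ (n - 1)) * M ^ n
      \<le> 2 ^ n * 2 ^ n * (1 / (8 * M)) ^ (n - 2) * cmod (w - z) * M ^ n"
    using assms(1) by (intro mult_right_mono) auto
  also have "\<dots> = 64 * M\<^sup>2 * cmod (w - z) * (1 / 2) ^ n"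
  proof -
    have "(2::real) ^ m * 2 ^ m * 2 ^ m = 8 ^ m"
      by (simp flip: power_mult_distrib)
    then show ?thesis
      using assms(1) by (simp add: m power_add power_divide power_mult_distrib field_simps power2_eq_square)
  qed
  finally show ?thesis .
qed

text \<open>From some index on the constant 1 suffices, and the finite sum in \<open>K\<close>
  absorbs the earlier terms. Index 0 is always among these: \<open>root 0\<close> is constantly 0
  and carries no information on \<open>c 0\<close>.\<close>

lemma geometric_bound_if_root_tendsto_0:
  fixes c :: "nat \<Rightarrow> real"
  assumes c: "\<And>n. 0 \<le> c n" and lim: "(\<lambda>n. root n (c n)) \<longlonglongrightarrow> 0" and e: "0 < e"
  shows "\<exists>K\<ge>0. \<forall>n. c n \<le> K * e ^ n"
proof -
  from order_tendstoD(2)[OF lim e] obtain N where N: "\<And>n. n \<ge> N \<Longrightarrow> root n (c n) < e"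
    by (auto simp: eventually_sequentially)
  define K where "K = 1 + (\<Sum>n\<le>N. c n / e ^ n)"
  have sum: "0 \<le> (\<Sum>n\<le>N. c n / e ^ n)" using c e by (intro sum_nonneg) auto
  have "c n \<le> K * e ^ n" for n
  proof (cases "n \<le> N")
    case True
    then have "c n / e ^ n \<le> (\<Sum>n\<le>N. c n / e ^ n)"
      using c e by (intro member_le_sum) auto
    then have "c n / e ^ n \<le> K" by (simp add: K_def)
    then show ?thesis using e by (simp add: field_simps)
  next
    case False
    then have "c n = root n (c n) ^ n" using c by simp
    also have "\<dots> \<le> e ^ n" using N[of n] False c e by (intro power_mono) auto
    also have "\<dots> \<le> K * e ^ n" using e sum by (simp add: K_def)
    finally show ?thesis .
  qed
  moreover have "K \<ge> 0" using sum by (simp add: K_def)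
  ultimately show ?thesis by blast
qed

section \<open>Convergence in terms of the calibration\<close>

locale complete_calibrated_space = complex_vector_space scale
  for scale :: "complex \<Rightarrow> 'a::{topological_ab_group_add, t2_space} \<Rightarrow> 'a" +
  fixes P :: "('a \<Rightarrow> real) set"
  assumes calibration: "calibration scale P"
    and complete: "sequentially_complete TYPE('a)"
begin

lemma seminorm: "p \<in> P \<Longrightarrow> seminorm scale p"
  using calibration by (simp add: calibration_def)

lemma seminorm_nonneg: "p \<in> P \<Longrightarrow> 0 \<le> p x"
  using seminorm by (auto simp: seminorm_def)

lemma seminorm_add: "p \<in> P \<Longrightarrow> p (x + y) \<le> p x + p y"
  using seminorm by (auto simp: seminorm_def)

lemma seminorm_scale: "p \<in> P \<Longrightarrow> p (scale c x) = cmod c * p x"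
  using seminorm by (auto simp: seminorm_def)

lemma seminorm_zero [simp]: "p \<in> P \<Longrightarrow> p 0 = 0"
  using seminorm_scale[of p 0 0] by simp

lemma seminorm_minus [simp]: "p \<in> P \<Longrightarrow> p (- x) = p x"
  using seminorm_scale[of p "- 1" x] by simp

lemma seminorm_diff: "p \<in> P \<Longrightarrow> p (x - y) \<le> p x + p y"
  using seminorm_add[of p x "- y"] by simp

lemma seminorm_diff_ge: "p \<in> P \<Longrightarrow> p x - p y \<le> p (x - y)"
  using seminorm_add[of p "x - y" y] by simp

lemma seminorm_diff_commute: "p \<in> P \<Longrightarrow> p (x - y) = p (y - x)"
  using seminorm_minus[of p "x - y"] by simp

lemma seminorm_sum: "p \<in> P \<Longrightarrow> p (sum f A) \<le> (\<Sum>i\<in>A. p (f i))"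
proof (induction A rule: infinite_finite_induct)
  case (insert i A)
  then show ?case using seminorm_add[of p "f i" "sum f A"] by simp
qed simp_all

text \<open>Induction on the generation of the topology. A subbasic ball need not be centred at
  \<open>l\<close>; the room left around \<open>l\<close> is \<open>r - p (l - x)\<close>.\<close>

lemma tendsto_iff_seminorms:
  "(f \<longlongrightarrow> l) F \<longleftrightarrow> (\<forall>p\<in>P. ((\<lambda>x. p (f x - l)) \<longlongrightarrow> 0) F)"
proof
  assume f: "(f \<longlongrightarrow> l) F"
  show "\<forall>p\<in>P. ((\<lambda>x. p (f x - l)) \<longlongrightarrow> 0) F"
  proof (intro ballI tendstoI)
    fix p and e :: real assume p: "p \<in> P" and e: "0 < e"
    have "generate_topology {{y. p (y - x) < r} | p x r. p \<in> P \<and> r > 0} {y. p (y - l) < e}"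
      using p e by (intro generate_topology.Basis) blast
    then have "open {y. p (y - l) < e}"
      using calibration by (simp add: calibration_def)
    then have "eventually (\<lambda>x. f x \<in> {y. p (y - l) < e}) F"
      using f p e by (intro topological_tendstoD) auto
    then show "eventually (\<lambda>x. dist (p (f x - l)) 0 < e) F"
      using seminorm_nonneg[OF p] by (simp add: dist_real_def)
  qed
next
  assume f: "\<forall>p\<in>P. ((\<lambda>x. p (f x - l)) \<longlongrightarrow> 0) F"
  show "(f \<longlongrightarrow> l) F"
  proof (rule topological_tendstoI)
    fix U assume "open U" and l: "l \<in> U"
    then have "generate_topology {{y. p (y - x) < r} | p x r. p \<in> P \<and> r > 0} U"
      using calibration by (simp add: calibration_def)
    then show "eventually (\<lambda>x. f x \<in> U) F" using l
    proof induction
      case (Int U V)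
      then show ?case by (auto elim: eventually_elim2)
    next
      case (UN K)
      then obtain U where "U \<in> K" "l \<in> U" by blast
      with UN.IH have "eventually (\<lambda>x. f x \<in> U) F" by blast
      then show ?case using \<open>U \<in> K\<close> by (auto elim!: eventually_mono)
    next
      case (Basis U)
      then obtain p x r where p: "p \<in> P" and U: "U = {y. p (y - x) < r}" and "p (l - x) < r" by auto
      then have "eventually (\<lambda>y. p (f y - l) < r - p (l - x)) F"
        using f p by (intro order_tendstoD(2)[where y = 0]) auto
      then show ?case
      proof eventually_elim
        case (elim y)
        then show ?case using seminorm_add[OF p, of "f y - l" "l - x"] by (simp add: U)
      qed
    qed simp
  qed
qed

lemma tendsto_seminorm:
  assumes "(f \<longlongrightarrow> l) F" "p \<in> P"
  shows "((\<lambda>x. p (f x)) \<longlongrightarrow> p l) F"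
proof -
  have "((\<lambda>x. p (f x - l)) \<longlongrightarrow> 0) F"
    using assms tendsto_iff_seminorms by blast
  then have "((\<lambda>x. p (f x) - p l) \<longlongrightarrow> 0) F"
  proof (rule Lim_null_comparison[rotated], intro always_eventually allI)
    show "norm (p (f x) - p l) \<le> p (f x - l)" for x
      using seminorm_diff_ge[OF assms(2), of "f x" l] seminorm_diff_ge[OF assms(2), of l "f x"]
        seminorm_diff_commute[OF assms(2), of "f x" l] by simp
  qed
  then show ?thesis by (simp add: LIM_zero_iff)
qed

text \<open>For each seminorm the differences \<open>u m - u n\<close> tend to 0 along the product
  filter, so \<open>tendsto_iff_seminorms\<close> supplies the neighbourhoods in the definition of
  completeness without any handling of finite intersections of balls.\<close>

lemma convergent_if_Cauchy:
  assumes "\<And>p. p \<in> P \<Longrightarrow> \<exists>e N. e \<longlonglongrightarrow> (0::real) \<and> (\<forall>m\<ge>N. \<forall>n\<ge>N. p (u m - u n) \<le> e m + e n)"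
  shows "\<exists>l. u \<longlonglongrightarrow> l"
proof -
  have "((\<lambda>(n, m). u m - u n) \<longlongrightarrow> 0) (sequentially \<times>\<^sub>F sequentially)"
    unfolding tendsto_iff_seminorms
  proof
    fix p assume p: "p \<in> P"
    from assms[OF p] obtain e N where e: "e \<longlonglongrightarrow> (0::real)"
      and le: "\<And>m n. m \<ge> N \<Longrightarrow> n \<ge> N \<Longrightarrow> p (u m - u n) \<le> e m + e n" by blast
    have "((\<lambda>x. e (snd x) + e (fst x)) \<longlongrightarrow> 0 + 0) (sequentially \<times>\<^sub>F sequentially)"
      by (intro tendsto_add filterlim_compose[OF e] filterlim_snd filterlim_fst)
    then have lim: "((\<lambda>(n, m). e m + e n) \<longlongrightarrow> 0) (sequentially \<times>\<^sub>F sequentially)"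
      by (simp add: case_prod_unfold add.commute)
    have "eventually (\<lambda>x. norm (p ((case x of (n, m) \<Rightarrow> u m - u n) - 0)) \<le> (case x of (n, m) \<Rightarrow> e m + e n))
        (sequentially \<times>\<^sub>F sequentially)"
      unfolding eventually_prod_sequentially using le seminorm_nonneg[OF p]
      by (intro exI[of _ N]) auto
    then show "((\<lambda>x. p ((case x of (n, m) \<Rightarrow> u m - u n) - 0)) \<longlongrightarrow> 0) (sequentially \<times>\<^sub>F sequentially)"
      using lim by (rule Lim_null_comparison)
  qed
  then have "\<exists>N. \<forall>m\<ge>N. \<forall>n\<ge>N. u m - u n \<in> U" if "open U" "0 \<in> U" for U
    using topological_tendstoD[OF _ that] by (fastforce simp: eventually_prod_sequentially)
  then show ?thesis
    using complete unfolding sequentially_complete_def convergent_def by blast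
qed

lemma sums_seminorm_le:
  assumes "y sums s" "p \<in> P" "\<And>n. p (y n) \<le> c * (1 / 2) ^ n"
  shows "p s \<le> 2 * c"
proof (rule tendsto_upperbound)
  show "(\<lambda>L. p (\<Sum>n<L. y n)) \<longlonglongrightarrow> p s"
    using assms(1,2) unfolding sums_def by (rule tendsto_seminorm)
  have "0 \<le> c"
    using assms(3)[of 0] seminorm_nonneg[OF assms(2), of "y 0"] by simp
  have "p (\<Sum>n<L. y n) \<le> 2 * c" for L
  proof -
    have "p (\<Sum>n<L. y n) \<le> (\<Sum>n<L. c * (1 / 2) ^ n)"
      using seminorm_sum[OF assms(2), of y "{..<L}"] assms(3) by (meson order_trans sum_mono)
    also have "\<dots> = c * (2 - 2 * (1 / 2) ^ L)"
      by (induction L) (auto simp: algebra_simps)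
    also have "\<dots> \<le> 2 * c" using \<open>0 \<le> c\<close> by (simp add: algebra_simps)
    finally show ?thesis .
  qed
  then show "\<forall>\<^sub>F L in sequentially. p (\<Sum>n<L. y n) \<le> 2 * c" by simp
qed simp

text \<open>The ratio 1/2 is fixed for all seminorms and only \<open>c\<close> varies; the series
  below are all estimated so as to leave this ratio.\<close>

lemma sums_geometric:
  assumes "\<And>p. p \<in> P \<Longrightarrow> \<exists>c. \<forall>n. p (y n) \<le> c * (1 / 2) ^ n"
  shows "\<exists>s. y sums s"
  unfolding sums_def
proof (rule convergent_if_Cauchy)
  fix p assume p: "p \<in> P"
  with assms obtain c where c: "\<And>n. p (y n) \<le> c * (1 / 2) ^ n" by blast
  have "0 \<le> c" using c[of 0] seminorm_nonneg[OF p, of "y 0"] by simp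
  have le: "p ((\<Sum>n<m. y n) - (\<Sum>n<L. y n)) \<le> 2 * c * (1 / 2) ^ L" if "L \<le> m" for m L
  proof -
    have "(\<Sum>n<m. y n) - (\<Sum>n<L. y n) = (\<Sum>n\<in>{L..<m}. y n)"
      using that by (simp add: lessThan_atLeast0 sum_diff_nat_ivl)
    also have "p \<dots> \<le> (\<Sum>n\<in>{L..<m}. c * (1 / 2) ^ n)"
      using seminorm_sum[OF p, of y "{L..<m}"] c by (meson order_trans sum_mono)
    also have "\<dots> = c * (2 * (1 / 2) ^ L - 2 * (1 / 2) ^ m)"
      using that by (induction m rule: dec_induct) (auto simp: algebra_simps)
    also have "\<dots> \<le> 2 * c * (1 / 2) ^ L" using \<open>0 \<le> c\<close> by (simp add: algebra_simps)
    finally show ?thesis .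
  qed
  show "\<exists>e N. e \<longlonglongrightarrow> (0::real) \<and>
      (\<forall>m\<ge>N. \<forall>n\<ge>N. p ((\<Sum>i<m. y i) - (\<Sum>i<n. y i)) \<le> e m + e n)"
  proof (intro exI conjI allI impI)
    show "(\<lambda>n. 2 * c * (1 / 2) ^ n) \<longlonglongrightarrow> 0"
      by (intro tendsto_mult_right_zero LIMSEQ_power_zero) simp
    show "p ((\<Sum>i<m. y i) - (\<Sum>i<n. y i)) \<le> 2 * c * (1 / 2) ^ m + 2 * c * (1 / 2) ^ n"
      if "0 \<le> m" "0 \<le> n" for m n
    proof (cases "m \<le> n")
      case True
      then show ?thesis
        using le[of m n] seminorm_diff_commute[OF p, of "\<Sum>i<m. y i"] \<open>0 \<le> c\<close>
        by (simp add: add_increasing2)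
    next
      case False
      then show ?thesis using le[of n m] \<open>0 \<le> c\<close> by (simp add: add_increasing)
    qed
  qed
qed

section \<open>Quotient bounded operators\<close>

lemma quotient_bounded_add: "T \<in> quotient_bounded scale P \<Longrightarrow> T (x + y) = T x + T y"
  by (simp add: quotient_bounded_def Vector_Spaces.linear_iff)

lemma quotient_bounded_scale: "T \<in> quotient_bounded scale P \<Longrightarrow> T (scale c x) = scale c (T x)"
  by (simp add: quotient_bounded_def Vector_Spaces.linear_iff)

lemma quotient_bounded_zero: "T \<in> quotient_bounded scale P \<Longrightarrow> T 0 = 0"
  using quotient_bounded_scale[of T 0 0] by simp

lemma quotient_bounded_diff: "T \<in> quotient_bounded scale P \<Longrightarrow> T (x - y) = T x - T y"
  using quotient_bounded_add[of T "x - y" y] by simp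

lemma quotient_bounded_sum: "T \<in> quotient_bounded scale P \<Longrightarrow> T (sum f A) = (\<Sum>i\<in>A. T (f i))"
  by (induction A rule: infinite_finite_induct)
    (auto simp: quotient_bounded_zero quotient_bounded_add)

lemma quotient_boundedD:
  assumes "T \<in> quotient_bounded scale P" "p \<in> P"
  shows "\<exists>c>0. \<forall>x. p (T x) \<le> c * p x"
  using assms by (simp add: quotient_bounded_def)

lemma quotient_boundedI:
  assumes "\<And>x y. T (x + y) = T x + T y" "\<And>c x. T (scale c x) = scale c (T x)"
    and "\<And>p. p \<in> P \<Longrightarrow> \<exists>c\<ge>0. \<forall>x. p (T x) \<le> c * p x"
  shows "T \<in> quotient_bounded scale P"
proof -
  have "\<exists>c>0. \<forall>x. p (T x) \<le> c * p x" if p: "p \<in> P" for p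
  proof -
    obtain c where "c \<ge> 0" "\<And>x. p (T x) \<le> c * p x" using assms(3)[OF p] by blast
    then have "c + 1 > 0" "\<And>x. p (T x) \<le> (c + 1) * p x"
      using seminorm_nonneg[OF p] by (auto simp: distrib_right intro: add_increasing2)
    then show ?thesis by blast
  qed
  then show ?thesis
    using assms(1,2) vector_space_axioms by (simp add: quotient_bounded_def Vector_Spaces.linear_iff)
qed

lemma tendsto_quotient_bounded:
  assumes T: "T \<in> quotient_bounded scale P" and f: "(f \<longlongrightarrow> l) F"
  shows "((\<lambda>x. T (f x)) \<longlongrightarrow> T l) F"
  unfolding tendsto_iff_seminorms
proof
  fix p assume p: "p \<in> P"
  obtain c where c: "\<And>x. p (T x) \<le> c * p x" using quotient_boundedD[OF T p] by blast
  have "((\<lambda>x. c * p (f x - l)) \<longlongrightarrow> 0) F"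
    using f p tendsto_iff_seminorms by (intro tendsto_mult_right_zero) blast
  then show "((\<lambda>x. p (T (f x) - T l)) \<longlongrightarrow> 0) F"
    by (rule Lim_null_comparison[rotated])
      (use c in \<open>auto simp: seminorm_nonneg[OF p] quotient_bounded_diff[OF T, symmetric]\<close>)
qed

lemma sums_quotient_bounded:
  assumes T: "T \<in> quotient_bounded scale P" and "y sums s"
  shows "(\<lambda>n. T (y n)) sums T s"
  using tendsto_quotient_bounded[OF T] assms(2) unfolding sums_def
  by (simp add: quotient_bounded_sum[OF T, symmetric])

lemma quotient_bounded_scalar: "scale l \<in> quotient_bounded scale P"
  by (rule quotient_boundedI)
    (auto simp: scale_right_distrib mult.commute seminorm_scale intro!: exI[of _ "cmod l"])

lemma quotient_bounded_compose:
  assumes T: "T \<in> quotient_bounded scale P" and S: "S \<in> quotient_bounded scale P"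
  shows "(\<lambda>x. T (S x)) \<in> quotient_bounded scale P"
proof (rule quotient_boundedI)
  fix p assume p: "p \<in> P"
  obtain c d where c: "c > 0" "\<And>x. p (T x) \<le> c * p x" and d: "d > 0" "\<And>x. p (S x) \<le> d * p x"
    using quotient_boundedD[OF T p] quotient_boundedD[OF S p] by blast
  have "p (T (S x)) \<le> c * d * p x" for x
  proof -
    have "p (T (S x)) \<le> c * p (S x)" by (rule c)
    also have "\<dots> \<le> c * (d * p x)" using c d by (intro mult_left_mono) auto
    finally show ?thesis by (simp add: mult.assoc)
  qed
  with c d show "\<exists>e\<ge>0. \<forall>x. p (T (S x)) \<le> e * p x"
    by (intro exI[of _ "c * d"]) auto
qed (simp_all add: assms quotient_bounded_add quotient_bounded_scale)

lemma quotient_bounded_minus: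
  assumes T: "T \<in> quotient_bounded scale P" and S: "S \<in> quotient_bounded scale P"
  shows "(\<lambda>x. T x - S x) \<in> quotient_bounded scale P"
proof (rule quotient_boundedI)
  fix p assume p: "p \<in> P"
  obtain c d where c: "c > 0" "\<And>x. p (T x) \<le> c * p x" and d: "d > 0" "\<And>x. p (S x) \<le> d * p x"
    using quotient_boundedD[OF T p] quotient_boundedD[OF S p] by blast
  have "p (T x - S x) \<le> (c + d) * p x" for x
    using seminorm_diff[OF p, of "T x" "S x"] c(2)[of x] d(2)[of x] by (simp add: distrib_right)
  with c d show "\<exists>e\<ge>0. \<forall>x. p (T x - S x) \<le> e * p x"
    by (intro exI[of _ "c + d"]) auto
qed (simp_all add: assms quotient_bounded_add quotient_bounded_scale scale_right_diff_distrib)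

text \<open>The infimum is itself an admissible constant: if \<open>p x > 0\<close>, every
  admissible \<open>r\<close> is at least \<open>p (T x) / p x\<close>; if \<open>p x = 0\<close>,
  then \<open>p (T x)\<close> vanishes as well.\<close>

lemma op_seminorm_bound:
  assumes T: "T \<in> quotient_bounded scale P" and p: "p \<in> P"
  shows "0 \<le> op_seminorm p T" "p (T x) \<le> op_seminorm p T * p x"
proof -
  define A where "A = {r. r > 0 \<and> (\<forall>x. p (T x) \<le> r * p x)}"
  have A: "A \<noteq> {}" using quotient_boundedD[OF T p] unfolding A_def by blast
  show "0 \<le> op_seminorm p T"
    unfolding op_seminorm_def A_def[symmetric] using A by (rule cInf_greatest) (auto simp: A_def)
  show "p (T x) \<le> op_seminorm p T * p x"
  proof (cases "p x = 0")
    case True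
    obtain c where "p (T x) \<le> c * p x" using quotient_boundedD[OF T p] by blast
    with True show ?thesis by simp
  next
    case False
    with seminorm_nonneg[OF p, of x] have x: "p x > 0" by simp
    then have "p (T x) / p x \<le> op_seminorm p T"
      unfolding op_seminorm_def A_def[symmetric] using A
      by (intro cInf_greatest) (auto simp: A_def field_simps)
    with x show ?thesis by (simp add: field_simps)
  qed
qed

section \<open>Bracket powers\<close>

lemma bracket_power_0 [simp]: "bracket_power scale S T 0 x = x"
  by (simp add: bracket_power_def)

text \<open>Pascal's rule: each product gains either an \<open>S\<close> on the left or a
  \<open>T\<close> on the right, so the order of the factors is respected.\<close>

lemma bracket_power_Suc:
  assumes S: "S \<in> quotient_bounded scale P"
  shows "bracket_power scale S T (Suc n) x = S (bracket_power scale S T n x) - bracket_power scale S T n (T x)"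
proof -
  define h where "h k = scale ((-1) ^ (Suc n - k) * of_nat (n choose k)) ((S ^^ k) ((T ^^ (Suc n - k)) x))" for k
  define y where "y k = (S ^^ Suc k) ((T ^^ (n - k)) x)" for k
  have SA: "S (bracket_power scale S T n x) = (\<Sum>k\<le>n. scale ((-1) ^ (n - k) * of_nat (n choose k)) (y k))"
    by (simp add: bracket_power_def y_def quotient_bounded_sum[OF S] quotient_bounded_scale[OF S])
  have "(\<Sum>k\<le>n. h k) = - bracket_power scale S T n (T x)"
    unfolding bracket_power_def sum_negf[symmetric] h_def
    by (intro sum.cong) (auto simp: Suc_diff_le funpow_swap1)
  \<comment> \<open>Since \<open>n choose Suc n\<close> is 0, the sum may be extended to
    \<open>Suc n\<close> and then shifted, which aligns \<open>h (Suc k)\<close> with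
    \<open>y k\<close> for Pascal's rule.\<close>
  moreover have "h (Suc n) = 0" by (simp add: h_def)
  ultimately have AT: "- bracket_power scale S T n (T x) = h 0 + (\<Sum>k\<le>n. h (Suc k))"
    using sum.atMost_Suc[of h n] sum.atMost_Suc_shift[of h n] by (metis add_0_right)
  have step: "scale ((-1) ^ (Suc n - Suc k) * of_nat (Suc n choose Suc k)) ((S ^^ Suc k) ((T ^^ (Suc n - Suc k)) x))
      = scale ((-1) ^ (n - k) * of_nat (n choose k)) (y k) + h (Suc k)" for k
    unfolding y_def h_def diff_Suc_Suc binomial_Suc_Suc of_nat_add distrib_left scale_left_distrib by (rule refl)
  have "bracket_power scale S T (Suc n) x = h 0 + (\<Sum>k\<le>n. scale ((-1) ^ (n - k) * of_nat (n choose k)) (y k) + h (Suc k))"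
    unfolding bracket_power_def sum.atMost_Suc_shift step by (simp add: h_def)
  also have "\<dots> = S (bracket_power scale S T n x) - bracket_power scale S T n (T x)"
    using SA AT by (simp add: sum.distrib)
  finally show ?thesis .
qed

lemma bracket_power_quotient_bounded:
  assumes S: "S \<in> quotient_bounded scale P" and T: "T \<in> quotient_bounded scale P"
  shows "bracket_power scale S T n \<in> quotient_bounded scale P"
proof (induction n)
  case 0
  show ?case by (rule quotient_boundedI) (auto intro: exI[of _ 1])
next
  case (Suc n)
  have "bracket_power scale S T (Suc n)
      = (\<lambda>x. S (bracket_power scale S T n x) - bracket_power scale S T n (T x))"
    using bracket_power_Suc[OF S] by blast
  then show ?case
    using Suc S T by (auto intro: quotient_bounded_minus quotient_bounded_compose)
qed

section \<open>Iterated local resolvents\<close>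

text \<open>Think of \<open>a k\<close> as \<open>(l I - T)\<^sup>-\<^sup>k x\<close>. The growth rate \<open>M\<close> is the same for all seminorms;
  only the constant depends on the seminorm.\<close>

definition resolvent_sequence :: "('a \<Rightarrow> 'a) \<Rightarrow> complex \<Rightarrow> 'a \<Rightarrow> (nat \<Rightarrow> 'a) \<Rightarrow> bool" where
  "resolvent_sequence T l x a \<longleftrightarrow> a 0 = x \<and> (\<forall>k. scale l (a (Suc k)) - T (a (Suc k)) = a k) \<and>
    (\<exists>M>0. \<forall>p\<in>P. \<exists>B. \<forall>k. p (a k) \<le> B * M ^ k)"

section \<open>From a local solution to a resolvent sequence\<close>

text \<open>The limit of the difference quotients passes through \<phi> because \<phi> is dominated
  by a seminorm of the calibration.\<close>

lemma lc_analytic_imp_holomorphic: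
  assumes f: "lc_analytic_on scale f D" and D: "open D" and p: "p \<in> P"
    and \<phi>: "\<And>x y. \<phi> (x + y) = \<phi> x + \<phi> y" "\<And>c x. \<phi> (scale c x) = c * \<phi> x"
    and le: "\<And>x. cmod (\<phi> x) \<le> 2 * p x"
  shows "(\<lambda>w. \<phi> (f w)) holomorphic_on D"
proof (rule holomorphic_onI)
  have diff: "\<phi> (x - y) = \<phi> x - \<phi> y" for x y using \<phi>(1)[of "x - y" y] by simp
  fix z assume z: "z \<in> D"
  with f obtain d where d: "((\<lambda>w. scale (inverse (w - z)) (f w - f z)) \<longlongrightarrow> d) (at z)"
    unfolding lc_analytic_on_def by blast
  have "((\<lambda>w. 2 * p (scale (inverse (w - z)) (f w - f z) - d)) \<longlongrightarrow> 0) (at z)"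
    using d p by (intro tendsto_mult_right_zero) (simp add: tendsto_iff_seminorms)
  then have "((\<lambda>w. \<phi> (scale (inverse (w - z)) (f w - f z) - d)) \<longlongrightarrow> 0) (at z)"
    by (rule Lim_null_comparison[rotated]) (use le in auto)
  then have "((\<lambda>w. \<phi> (scale (inverse (w - z)) (f w - f z))) \<longlongrightarrow> \<phi> d) (at z)"
    by (simp add: diff LIM_zero_iff)
  then have "((\<lambda>w. (\<phi> (f w) - \<phi> (f z)) / (w - z)) \<longlongrightarrow> \<phi> d) (at z)"
    by (simp add: \<phi>(2) diff divide_inverse mult.commute)
  then have "((\<lambda>w. \<phi> (f w)) has_field_derivative \<phi> d) (at z)"
    by (simp add: has_field_derivative_iff)
  then show "(\<lambda>w. \<phi> (f w)) field_differentiable at z within D"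
    using field_differentiable_at_within field_differentiable_def by blast
qed

text \<open>Used to bound \<open>p (f w)\<close> on a compact disc. Multiplying \<open>p\<close> of
  the difference quotient, which converges, by \<open>cmod (w - z)\<close> gives continuity.\<close>

lemma lc_analytic_seminorm_continuous:
  assumes f: "lc_analytic_on scale f D" and p: "p \<in> P"
  shows "continuous_on D (\<lambda>w. p (f w))"
proof (rule continuous_at_imp_continuous_on, rule ballI)
  fix z assume "z \<in> D"
  with f obtain d where d: "((\<lambda>w. scale (inverse (w - z)) (f w - f z)) \<longlongrightarrow> d) (at z)"
    unfolding lc_analytic_on_def by blast
  have "((\<lambda>w. cmod (w - z) * p (scale (inverse (w - z)) (f w - f z))) \<longlongrightarrow> cmod (z - z) * p d) (at z)"
    by (intro tendsto_intros tendsto_seminorm[OF d p])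
  then have lim: "((\<lambda>w. cmod (w - z) * p (scale (inverse (w - z)) (f w - f z))) \<longlongrightarrow> 0) (at z)"
    by simp
  have "((\<lambda>w. p (f w) - p (f z)) \<longlongrightarrow> 0) (at z)"
  proof (rule Lim_null_comparison[OF _ lim], rule eventually_at_filter[THEN iffD2], rule always_eventually, intro allI impI)
    fix w assume "w \<noteq> z"
    then have "cmod (w - z) * p (scale (inverse (w - z)) (f w - f z)) = p (f w - f z)"
      using p by (simp add: seminorm_scale norm_inverse)
    then show "norm (p (f w) - p (f z)) \<le> cmod (w - z) * p (scale (inverse (w - z)) (f w - f z))"
      using seminorm_diff_ge[OF p, of "f w" "f z"] seminorm_diff_ge[OF p, of "f z" "f w"]
        seminorm_diff_commute[OF p, of "f w" "f z"] by simp
  qed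
  then show "isCont (\<lambda>w. p (f w)) z"
    unfolding isCont_def by (simp add: LIM_zero_iff)
qed

text \<open>The Cauchy integrals for the Taylor coefficients, approximated by averages over the
  \<open>N\<close>-th roots of unity.\<close>

definition circle_average :: "(complex \<Rightarrow> 'a) \<Rightarrow> complex \<Rightarrow> real \<Rightarrow> nat \<Rightarrow> nat \<Rightarrow> 'a" where
  "circle_average f l r k N = scale (inverse (of_nat N)) (\<Sum>j<N.
    scale (inverse ((of_real r * root_of_unity N j) ^ k)) (f (l + of_real r * root_of_unity N j)))"

lemma circle_average_functional:
  assumes \<phi>: "\<And>x y. \<phi> (x + y) = \<phi> x + \<phi> y" "\<And>c x. \<phi> (scale c x) = c * \<phi> x"
  shows "\<phi> (circle_average f l r k N) = (\<Sum>j<N. \<phi> (f (l + of_real r * root_of_unity N j)) /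
    (of_real r * root_of_unity N j) ^ k) / of_nat N"
proof -
  have "\<phi> 0 = 0" using \<phi>(2)[of 0 0] by simp
  then have sum: "\<phi> (sum g A) = (\<Sum>j\<in>A. \<phi> (g j))" for g and A :: "nat set"
    by (induction A rule: infinite_finite_induct) (auto simp: \<phi>(1))
  show ?thesis
    unfolding circle_average_def \<phi>(2) sum by (simp add: divide_inverse mult.commute)
qed

lemma circle_average_seminorm_le:
  assumes p: "p \<in> P" and B: "\<And>w. dist l w = r \<Longrightarrow> p (f w) \<le> B" and r: "0 < r" and N: "0 < N"
  shows "p (circle_average f l r k N) \<le> B / r ^ k"
proof -
  have "p (circle_average f l r k N) = inverse (real N) * p (\<Sum>j<N.
      scale (inverse ((of_real r * root_of_unity N j) ^ k)) (f (l + of_real r * root_of_unity N j)))"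
    using p by (simp add: circle_average_def seminorm_scale norm_inverse)
  also have "\<dots> \<le> inverse (real N) * (\<Sum>j<N. B / r ^ k)"
  proof (intro mult_left_mono order_trans[OF seminorm_sum[OF p]] sum_mono)
    fix j
    have "p (f (l + of_real r * root_of_unity N j)) \<le> B"
      using r by (intro B) (simp add: dist_norm norm_mult)
    moreover have "p (scale (inverse ((of_real r * root_of_unity N j) ^ k)) (f (l + of_real r * root_of_unity N j)))
        = p (f (l + of_real r * root_of_unity N j)) / r ^ k"
      using r by (simp add: seminorm_scale[OF p] norm_inverse norm_power norm_mult divide_inverse mult.commute)
    ultimately show "p (scale (inverse ((of_real r * root_of_unity N j) ^ k)) (f (l + of_real r * root_of_unity N j)))
        \<le> B / r ^ k"
      using r by (simp add: divide_right_mono)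
  qed simp
  also have "\<dots> = B / r ^ k" using N by simp
  finally show ?thesis .
qed

lemma circle_average_functional_approx:
  assumes f: "lc_analytic_on scale f D" and D: "open D" "cball l r \<subseteq> D" and r: "0 < r"
    and p: "p \<in> P" and B: "\<And>w. w \<in> cball l r \<Longrightarrow> p (f w) \<le> B"
    and \<phi>: "\<And>x y. \<phi> (x + y) = \<phi> x + \<phi> y" "\<And>c x. \<phi> (scale c x) = c * \<phi> x"
    and le: "\<And>x. cmod (\<phi> x) \<le> 2 * p x" and k: "k < N"
  shows "cmod (\<phi> (circle_average f l (r / 2) k N) - (deriv ^^ k) (\<lambda>w. \<phi> (f w)) l / fact k)
    \<le> 4 * B / (r ^ k * 2 ^ N)"
proof -
  have hol: "(\<lambda>w. \<phi> (f w)) holomorphic_on D"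
    by (rule lc_analytic_imp_holomorphic[OF f D(1) p \<phi> le])
  \<comment> \<open>The factor 2 from \<open>Hahn_Banach_seminorm\<close> is what turns
    \<open>2 * B\<close> into \<open>4 * B\<close> in the error.\<close>
  have "cmod (\<phi> (f w)) \<le> 2 * B" if "w \<in> cball l r" for w
    using le[of "f w"] B[OF that] by simp
  moreover have "(\<lambda>w. \<phi> (f w)) holomorphic_on ball l r"
    using hol D(2) ball_subset_cball holomorphic_on_subset by blast
  moreover have "continuous_on (cball l r) (\<lambda>w. \<phi> (f w))"
    using hol D(2) holomorphic_on_imp_continuous_on continuous_on_subset by blast
  ultimately have "cmod ((\<Sum>j<N. \<phi> (f (l + of_real (r / 2) * root_of_unity N j)) /
      (of_real (r / 2) * root_of_unity N j) ^ k) / of_nat N - (deriv ^^ k) (\<lambda>w. \<phi> (f w)) l / fact k)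
      \<le> 2 * (2 * B) / (r ^ k * 2 ^ N)"
    using r k by (intro root_average_Taylor_coefficient) auto
  then show ?thesis
    unfolding circle_average_functional[of \<phi>, OF \<phi>] by simp
qed

text \<open>The functional is chosen for the difference \<open>?y\<close> itself. Under it both
  averages approximate the same scalar Taylor coefficient, so they are compared without knowing yet
  that this coefficient comes from a vector of the space.\<close>

lemma circle_average_diff_le:
  assumes f: "lc_analytic_on scale f D" and D: "open D" "cball l r \<subseteq> D" and r: "0 < r"
    and p: "p \<in> P" and B: "\<And>w. w \<in> cball l r \<Longrightarrow> p (f w) \<le> B" and N: "k < N" "k < N'"
  shows "p (circle_average f l (r / 2) k N - circle_average f l (r / 2) k N')
    \<le> 4 * B / (r ^ k * 2 ^ N) + 4 * B / (r ^ k * 2 ^ N')" (is "p ?y \<le> _")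
proof -
  obtain \<phi> where \<phi>: "\<And>x y. \<phi> (x + y) = \<phi> x + \<phi> y" "\<And>c x. \<phi> (scale c x) = c * \<phi> x"
    "\<And>x. cmod (\<phi> x) \<le> 2 * p x" "p ?y \<le> Re (\<phi> ?y)"
    using Hahn_Banach_seminorm[OF seminorm[OF p]] by metis
  have "\<phi> ?y = \<phi> (circle_average f l (r / 2) k N) - \<phi> (circle_average f l (r / 2) k N')"
    using \<phi>(1)[of ?y "circle_average f l (r / 2) k N'"] by simp
  moreover define c where "c = (deriv ^^ k) (\<lambda>w. \<phi> (f w)) l / fact k"
  ultimately have "cmod (\<phi> ?y) \<le> cmod (\<phi> (circle_average f l (r / 2) k N) - c)
      + cmod (\<phi> (circle_average f l (r / 2) k N') - c)"
    using norm_triangle_ineq4[of "\<phi> (circle_average f l (r / 2) k N) - c"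
        "\<phi> (circle_average f l (r / 2) k N') - c"] by simp
  also have "\<dots> \<le> 4 * B / (r ^ k * 2 ^ N) + 4 * B / (r ^ k * 2 ^ N')"
    unfolding c_def using N
    by (intro add_mono circle_average_functional_approx[of f D l r p B \<phi>, OF f D r p B \<phi>(1-3)])
  finally have "cmod (\<phi> ?y) \<le> 4 * B / (r ^ k * 2 ^ N) + 4 * B / (r ^ k * 2 ^ N')" .
  then show ?thesis
    using \<phi>(4) complex_Re_le_cmod[of "\<phi> ?y"] by linarith
qed

text \<open>The same argument for \<open>k = 0\<close>, where the scalar Taylor coefficient is
  \<phi> (f l) and so does come from a known vector.\<close>

lemma circle_average_center_le:
  assumes f: "lc_analytic_on scale f D" and D: "open D" "cball l r \<subseteq> D" and r: "0 < r"
    and p: "p \<in> P" and B: "\<And>w. w \<in> cball l r \<Longrightarrow> p (f w) \<le> B" and N: "0 < N"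
  shows "p (circle_average f l (r / 2) 0 N - f l) \<le> 4 * B / 2 ^ N" (is "p ?y \<le> _")
proof -
  obtain \<phi> where \<phi>: "\<And>x y. \<phi> (x + y) = \<phi> x + \<phi> y" "\<And>c x. \<phi> (scale c x) = c * \<phi> x"
    "\<And>x. cmod (\<phi> x) \<le> 2 * p x" "p ?y \<le> Re (\<phi> ?y)"
    using Hahn_Banach_seminorm[OF seminorm[OF p]] by metis
  have "\<phi> ?y = \<phi> (circle_average f l (r / 2) 0 N) - \<phi> (f l)"
    using \<phi>(1)[of ?y "f l"] by simp
  then have "cmod (\<phi> ?y) \<le> 4 * B / 2 ^ N"
    using circle_average_functional_approx[of f D l r p B \<phi>, OF f D r p B \<phi>(1-3) N] by simp
  then show ?thesis
    using \<phi>(4) complex_Re_le_cmod[of "\<phi> ?y"] by linarith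
qed

text \<open>The recursion holds exactly for each \<open>N\<close>, not only in the limit. At
  \<open>l + z\<close> the equation reads (l I - T) f = x - z f, so dividing by
  \<open>z ^ Suc k\<close> lowers the exponent in the second term, and the multiples of
  \<open>x\<close> cancel because the powers \<open>z ^ Suc k\<close> have inverses summing to 0
  when \<open>Suc k < N\<close>.\<close>

lemma circle_average_resolvent:
  assumes T: "T \<in> quotient_bounded scale P" and r: "0 < r" and N: "Suc k < N"
    and eq: "\<And>w. dist l w = r \<Longrightarrow> scale w (f w) - T (f w) = x"
  shows "scale l (circle_average f l r (Suc k) N) - T (circle_average f l r (Suc k) N)
    = - circle_average f l r k N"
proof -
  define z where "z j = of_real r * root_of_unity N j" for j
  have z: "z j \<noteq> 0" "dist l (l + z j) = r" for j
    using r by (auto simp: z_def dist_norm norm_mult)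
  have step: "scale l (scale (inverse (z j ^ Suc k)) (f (l + z j))) - T (scale (inverse (z j ^ Suc k)) (f (l + z j)))
      = scale (inverse (z j ^ Suc k)) x - scale (inverse (z j ^ k)) (f (l + z j))" for j
  proof -
    have "scale l (f (l + z j)) - T (f (l + z j)) = x - scale (z j) (f (l + z j))"
      using eq[OF z(2)[of j]] by (simp add: scale_left_distrib algebra_simps)
    then have "scale (inverse (z j ^ Suc k)) (scale l (f (l + z j)) - T (f (l + z j)))
        = scale (inverse (z j ^ Suc k)) x - scale (inverse (z j ^ Suc k) * z j) (f (l + z j))"
      by (simp add: scale_right_diff_distrib)
    moreover have "inverse (z j ^ Suc k) * z j = inverse (z j ^ k)" using z(1)[of j] by simp
    ultimately show ?thesis
      by (simp only: scale_right_diff_distrib quotient_bounded_scale[OF T] scale_scale mult.commute)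
  qed
  have "(\<Sum>j<N. inverse (z j ^ Suc k)) = inverse (of_real r ^ Suc k)
      * (\<Sum>j<N. root_of_unity N j ^ 0 / root_of_unity N j ^ Suc k)"
    by (simp add: z_def power_mult_distrib sum_distrib_left divide_inverse mult_ac)
  also have "\<dots> = 0" using N by (subst sum_root_of_unity_quotients) auto
  finally have "(\<Sum>j<N. scale (inverse (z j ^ Suc k)) x) = 0"
    by (simp only: scale_sum_left[symmetric] scale_zero_left)
  then have "scale l (\<Sum>j<N. scale (inverse (z j ^ Suc k)) (f (l + z j)))
      - T (\<Sum>j<N. scale (inverse (z j ^ Suc k)) (f (l + z j)))
      = - (\<Sum>j<N. scale (inverse (z j ^ k)) (f (l + z j)))"
    unfolding scale_sum_right quotient_bounded_sum[OF T] sum_subtractf[symmetric] step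
    by (simp add: sum_subtractf)
  then have "scale (inverse (of_nat N)) (scale l (\<Sum>j<N. scale (inverse (z j ^ Suc k)) (f (l + z j)))
      - T (\<Sum>j<N. scale (inverse (z j ^ Suc k)) (f (l + z j))))
      = - scale (inverse (of_nat N)) (\<Sum>j<N. scale (inverse (z j ^ k)) (f (l + z j)))"
    by (simp only: scale_minus_right)
  then show ?thesis
    unfolding circle_average_def z_def
    by (simp only: scale_right_diff_distrib quotient_bounded_scale[OF T] scale_left_commute)
qed

lemma local_resolvent_imp_sequence:
  assumes T: "T \<in> quotient_bounded scale P" and l: "l \<in> local_resolvent_set scale T x"
  shows "\<exists>a. resolvent_sequence T l x a"
proof -
  obtain D f where D: "open D" "l \<in> D" and f: "lc_analytic_on scale f D"
    and eq: "\<And>w. w \<in> D \<Longrightarrow> scale w (f w) - T (f w) = x"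
    using l unfolding local_resolvent_set_def by blast
  obtain r where r: "0 < r" "cball l r \<subseteq> D"
    using D open_contains_cball by blast
  have bound: "\<exists>B\<ge>0. \<forall>w\<in>cball l r. p (f w) \<le> B" if p: "p \<in> P" for p
  proof -
    have "continuous_on (cball l r) (\<lambda>w. p (f w))"
      using lc_analytic_seminorm_continuous[OF f p] r(2) continuous_on_subset by blast
    then have "compact ((\<lambda>w. p (f w)) ` cball l r)"
      by (intro compact_continuous_image compact_cball)
    then obtain B where "\<And>w. w \<in> cball l r \<Longrightarrow> norm (p (f w)) \<le> B"
      using compact_imp_bounded bounded_iff by (metis imageI)
    then have "\<forall>w\<in>cball l r. p (f w) \<le> max 0 B" by fastforce
    then show ?thesis by (intro exI[of _ "max 0 B"]) auto
  qed
  have "\<exists>d. circle_average f l (r / 2) k \<longlonglongrightarrow> d" for k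
  proof (rule convergent_if_Cauchy)
    fix p assume p: "p \<in> P"
    from bound[OF p] obtain B where B: "\<And>w. w \<in> cball l r \<Longrightarrow> p (f w) \<le> B" by blast
    have "(\<lambda>N. 4 * B / r ^ k * (1 / 2) ^ N) \<longlonglongrightarrow> 0"
      by (intro tendsto_mult_right_zero LIMSEQ_power_zero) simp
    then have "(\<lambda>N. 4 * B / (r ^ k * 2 ^ N)) \<longlonglongrightarrow> 0" by (simp add: power_divide)
    moreover have "\<forall>m\<ge>Suc k. \<forall>n\<ge>Suc k. p (circle_average f l (r / 2) k m - circle_average f l (r / 2) k n)
        \<le> 4 * B / (r ^ k * 2 ^ m) + 4 * B / (r ^ k * 2 ^ n)"
      using circle_average_diff_le[OF f D(1) r(2) r(1) p B] by auto
    ultimately show "\<exists>e N. e \<longlonglongrightarrow> (0::real) \<and> (\<forall>m\<ge>N. \<forall>n\<ge>N.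
        p (circle_average f l (r / 2) k m - circle_average f l (r / 2) k n) \<le> e m + e n)"
      by blast
  qed
  then obtain d where d: "\<And>k. circle_average f l (r / 2) k \<longlonglongrightarrow> d k" by metis
  \<comment> \<open>The limit for \<open>k = 0\<close> must be \<open>f l\<close>: the equation for
    \<open>f\<close> at \<open>l\<close> is the first step of the recursion, the one that reaches
    \<open>x\<close>.\<close>
  have "circle_average f l (r / 2) 0 \<longlonglongrightarrow> f l"
    unfolding tendsto_iff_seminorms
  proof
    fix p assume p: "p \<in> P"
    from bound[OF p] obtain B where B: "\<And>w. w \<in> cball l r \<Longrightarrow> p (f w) \<le> B" by blast
    have "(\<lambda>N. 4 * B * (1 / 2) ^ N) \<longlonglongrightarrow> 0"
      by (intro tendsto_mult_right_zero LIMSEQ_power_zero) simp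
    then have lim: "(\<lambda>N. 4 * B / 2 ^ N) \<longlonglongrightarrow> 0" by (simp add: power_divide)
    have "eventually (\<lambda>N. norm (p (circle_average f l (r / 2) 0 N - f l)) \<le> 4 * B / 2 ^ N) sequentially"
      using eventually_gt_at_top[of 0]
      by eventually_elim
        (use circle_average_center_le[OF f D(1) r(2) r(1) p B] seminorm_nonneg[OF p] in auto)
    then show "(\<lambda>N. p (circle_average f l (r / 2) 0 N - f l)) \<longlonglongrightarrow> 0"
      using lim by (rule Lim_null_comparison)
  qed
  with d[of 0] have d0: "d 0 = f l" by (rule LIMSEQ_unique)
  have dSuc: "scale l (d (Suc k)) - T (d (Suc k)) = - d k" for k
  proof -
    have "(\<lambda>N. scale l (circle_average f l (r / 2) (Suc k) N) - T (circle_average f l (r / 2) (Suc k) N))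
        \<longlonglongrightarrow> scale l (d (Suc k)) - T (d (Suc k))"
      by (intro tendsto_diff tendsto_quotient_bounded[OF T] tendsto_quotient_bounded[OF quotient_bounded_scalar] d)
    moreover have "eventually (\<lambda>N. scale l (circle_average f l (r / 2) (Suc k) N)
        - T (circle_average f l (r / 2) (Suc k) N) = - circle_average f l (r / 2) k N) sequentially"
      using eventually_gt_at_top[of "Suc k"]
      by eventually_elim (rule circle_average_resolvent[OF T], use r eq in \<open>auto simp: subset_iff\<close>)
    ultimately have "(\<lambda>N. - circle_average f l (r / 2) k N) \<longlonglongrightarrow> scale l (d (Suc k)) - T (d (Suc k))"
      by (rule Lim_transform_eventually)
    moreover have "(\<lambda>N. - circle_average f l (r / 2) k N) \<longlonglongrightarrow> - d k"
      by (intro tendsto_minus d)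
    ultimately show ?thesis by (rule LIMSEQ_unique)
  qed
  have d_le: "p (d k) \<le> B / (r / 2) ^ k"
    if p: "p \<in> P" and B: "\<And>w. w \<in> cball l r \<Longrightarrow> p (f w) \<le> B" for p B k
  proof (rule tendsto_upperbound)
    show "(\<lambda>N. p (circle_average f l (r / 2) k N)) \<longlonglongrightarrow> p (d k)"
      using d p by (rule tendsto_seminorm)
    show "eventually (\<lambda>N. p (circle_average f l (r / 2) k N) \<le> B / (r / 2) ^ k) sequentially"
      using eventually_gt_at_top[of 0]
      by eventually_elim (rule circle_average_seminorm_le[OF p], use B r in auto)
  qed simp
  define a where "a k = (case k of 0 \<Rightarrow> x | Suc m \<Rightarrow> scale ((-1) ^ m) (d m))" for k
  have "scale l (a (Suc k)) - T (a (Suc k)) = a k" for k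
  proof (cases k)
    case 0
    then show ?thesis using eq[OF D(2)] by (simp add: a_def d0)
  next
    case (Suc m)
    have "scale l (a (Suc k)) - T (a (Suc k)) = scale ((-1) ^ k) (scale l (d k) - T (d k))"
      by (simp only: a_def nat.case scale_right_diff_distrib quotient_bounded_scale[OF T] scale_left_commute)
    also have "\<dots> = a k" by (simp add: Suc dSuc a_def)
    finally show ?thesis .
  qed
  moreover have "\<exists>B. \<forall>k. p (a k) \<le> B * (2 / r) ^ k" if p: "p \<in> P" for p
  proof -
    from bound[OF p] obtain B where B: "B \<ge> 0" "\<And>w. w \<in> cball l r \<Longrightarrow> p (f w) \<le> B" by blast
    \<comment> \<open>The summand \<open>p x\<close> serves index 0; the factor \<open>r / 2\<close>
      next to \<open>B\<close> pays for the shift between \<open>a (Suc m)\<close> and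
      \<open>d m\<close>.\<close>
    have "p (a k) \<le> (p x + B * r / 2) * (2 / r) ^ k" for k
    proof (cases k)
      case 0
      then show ?thesis using B r by (simp add: a_def)
    next
      case (Suc m)
      have "p (a k) = p (d m)"
        by (simp add: Suc a_def seminorm_scale[OF p] norm_power)
      also have "\<dots> \<le> B / (r / 2) ^ m" using p B(2) by (rule d_le)
      also have "\<dots> = B * r / 2 * (2 / r) ^ k" using r by (simp add: Suc power_divide field_simps)
      also have "\<dots> \<le> (p x + B * r / 2) * (2 / r) ^ k"
        using r seminorm_nonneg[OF p] by (intro mult_right_mono) auto
      finally show ?thesis .
    qed
    then show ?thesis by blast
  qed
  moreover have "a 0 = x" "2 / r > 0" using r by (simp_all add: a_def)
  ultimately have "resolvent_sequence T l x a"
    unfolding resolvent_sequence_def by blast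
  then show ?thesis by blast
qed

section \<open>From a resolvent sequence to a local solution\<close>

text \<open>Termwise differentiation. The radius \<open>1 / (8 * M)\<close> lies well inside the
  disc of radius \<open>1 / M\<close>, so that the factors \<open>k\<close> and
  \<open>k * (k - 1)\<close> can be bounded crudely by powers of 2 and the ratio 1/2 still
  remains.\<close>

lemma power_series_lc_analytic:
  assumes M: "M > 0" and a: "\<And>p. p \<in> P \<Longrightarrow> \<exists>B. \<forall>k. p (a k) \<le> B * M ^ k"
    and f: "\<And>w. cmod (w - l) < 1 / (8 * M) \<Longrightarrow> (\<lambda>k. scale ((w - l) ^ k) (a k)) sums f w"
  shows "lc_analytic_on scale f (ball l (1 / (8 * M)))"
  unfolding lc_analytic_on_def
proof
  fix z assume "z \<in> ball l (1 / (8 * M))"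
  then have z: "cmod (z - l) < 1 / (8 * M)" by (simp add: dist_norm norm_minus_commute)
  have "\<exists>d. (\<lambda>k. scale (of_nat k * (z - l) ^ (k - 1)) (a k)) sums d"
  proof (rule sums_geometric)
    fix p assume p: "p \<in> P"
    from a[OF p] obtain B where B: "\<And>k. p (a k) \<le> B * M ^ k" by blast
    have B0: "0 \<le> B" using B[of 0] seminorm_nonneg[OF p, of "a 0"] by simp
    \<comment> \<open>The power of \<open>z - l\<close> is one lower than that of \<open>M\<close>,
      whence the factor \<open>8 * M\<close>. At \<open>k = 0\<close>, where \<open>k - 1\<close> is
      truncated, the term is zero.\<close>
    have "p (scale (of_nat k * (z - l) ^ (k - 1)) (a k)) \<le> 8 * M * B * (1 / 2) ^ k" for k
    proof (cases k)
      case 0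
      then show ?thesis using B0 M p by simp
    next
      case (Suc m)
      have "p (scale (of_nat k * (z - l) ^ (k - 1)) (a k)) = of_nat k * cmod (z - l) ^ m * p (a k)"
        by (simp add: Suc seminorm_scale[OF p] norm_mult norm_power del: of_nat_Suc)
      also have "\<dots> \<le> 2 ^ k * (1 / (8 * M)) ^ m * (B * M ^ k)"
        using z M B B0 seminorm_nonneg[OF p] of_nat_less_two_power[of k, where 'a = real]
        by (intro mult_mono power_mono) auto
      also have "\<dots> = 8 * M * B * (1 / 4) ^ k"
      proof -
        have "(2::real) ^ m * 4 ^ m = 8 ^ m" by (simp flip: power_mult_distrib)
        then show ?thesis using M by (simp add: Suc power_divide power_mult_distrib field_simps)
      qed
      also have "\<dots> \<le> 8 * M * B * (1 / 2) ^ k"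
        using M B0 by (intro mult_left_mono power_mono) auto
      finally show ?thesis .
    qed
    then show "\<exists>c. \<forall>k. p (scale (of_nat k * (z - l) ^ (k - 1)) (a k)) \<le> c * (1 / 2) ^ k" by blast
  qed
  then obtain d where d: "(\<lambda>k. scale (of_nat k * (z - l) ^ (k - 1)) (a k)) sums d" by blast
  have "((\<lambda>w. scale (inverse (w - z)) (f w - f z)) \<longlongrightarrow> d) (at z)"
    unfolding tendsto_iff_seminorms
  proof
    fix p assume p: "p \<in> P"
    from a[OF p] obtain B where B: "\<And>k. p (a k) \<le> B * M ^ k" by blast
    have B0: "0 \<le> B" using B[of 0] seminorm_nonneg[OF p, of "a 0"] by simp
    \<comment> \<open>The error of the difference quotient is again a series; its coefficients
      \<open>c k\<close> are those of \<open>power_difference_quotient_bound\<close>, which makes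
      the sum of order \<open>cmod (w - z)\<close>.\<close>
    have le: "p (scale (inverse (w - z)) (f w - f z) - d) \<le> 2 * (64 * M\<^sup>2 * cmod (w - z) * B)"
      if w: "w \<noteq> z" "cmod (w - l) < 1 / (8 * M)" for w
    proof (rule sums_seminorm_le[OF _ p])
      define c where "c k = ((w - l) ^ k - (z - l) ^ k) / (w - z) - of_nat k * (z - l) ^ (k - 1)" for k
      have "(\<lambda>k. scale (inverse (w - z)) (scale ((w - l) ^ k) (a k) - scale ((z - l) ^ k) (a k))
          - scale (of_nat k * (z - l) ^ (k - 1)) (a k)) sums (scale (inverse (w - z)) (f w - f z) - d)"
        by (intro sums_diff_group sums_quotient_bounded[OF quotient_bounded_scalar] f d z w)
      moreover have "scale (inverse (w - z)) (scale ((w - l) ^ k) (a k) - scale ((z - l) ^ k) (a k))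
          - scale (of_nat k * (z - l) ^ (k - 1)) (a k) = scale (c k) (a k)" for k
        by (simp add: c_def scale_left_diff_distrib[symmetric] divide_inverse mult.commute)
      ultimately show "(\<lambda>k. scale (c k) (a k)) sums (scale (inverse (w - z)) (f w - f z) - d)"
        by simp
      fix k
      have "p (scale (c k) (a k)) \<le> cmod (c k) * (B * M ^ k)"
        unfolding seminorm_scale[OF p] using B by (intro mult_left_mono) auto
      also have "\<dots> = cmod (c k) * M ^ k * B" by simp
      also have "\<dots> \<le> 64 * M\<^sup>2 * cmod (w - z) * (1 / 2) ^ k * B"
        using power_difference_quotient_bound[OF M, of "z - l" "w - l" k] z w B0
        unfolding c_def by (intro mult_right_mono) auto
      finally show "p (scale (c k) (a k)) \<le> 64 * M\<^sup>2 * cmod (w - z) * B * (1 / 2) ^ k"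
        by (simp add: mult_ac)
    qed
    have "((\<lambda>w. 2 * (64 * M\<^sup>2 * cmod (w - z) * B)) \<longlongrightarrow> 2 * (64 * M\<^sup>2 * cmod (z - z) * B)) (at z)"
      by (intro tendsto_intros)
    then have lim: "((\<lambda>w. 2 * (64 * M\<^sup>2 * cmod (w - z) * B)) \<longlongrightarrow> 0) (at z)" by simp
    have "eventually (\<lambda>w. w \<in> ball l (1 / (8 * M)) - {z}) (at z)"
      using z M by (intro eventually_at_in_open) (auto simp: dist_norm norm_minus_commute)
    then have "eventually (\<lambda>w. norm (p (scale (inverse (w - z)) (f w - f z) - d))
        \<le> 2 * (64 * M\<^sup>2 * cmod (w - z) * B)) (at z)"
      by eventually_elim
        (use le seminorm_nonneg[OF p] in \<open>auto simp: dist_norm norm_minus_commute\<close>)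
    then show "((\<lambda>w. p (scale (inverse (w - z)) (f w - f z) - d)) \<longlongrightarrow> 0) (at z)"
      using lim by (rule Lim_null_comparison)
  qed
  then show "\<exists>d. ((\<lambda>w. scale (inverse (w - z)) (f w - f z)) \<longlongrightarrow> d) (at z)" by blast
qed

text \<open>Writing w I - T as (l I - T) - (l - w) I, its action on the \<open>k\<close>-th term of
  the series is \<open>v k - v (Suc k)\<close>. The sum telescopes to \<open>v 0\<close>, which is
  \<open>x\<close>.\<close>

lemma sequence_imp_local_resolvent:
  assumes T: "T \<in> quotient_bounded scale P" and a: "resolvent_sequence T l x a"
  shows "l \<in> local_resolvent_set scale T x"
proof -
  obtain M where M: "M > 0" and B: "\<And>p. p \<in> P \<Longrightarrow> \<exists>B. \<forall>k. p (a k) \<le> B * M ^ k"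
    using a unfolding resolvent_sequence_def by blast
  have a0: "a 0 = x" and aSuc: "\<And>k. scale l (a (Suc k)) - T (a (Suc k)) = a k"
    using a unfolding resolvent_sequence_def by auto
  define c where "c k = scale ((-1) ^ k) (a (Suc k))" for k
  have c: "\<exists>B. \<forall>k. p (c k) \<le> B * M ^ k" if p: "p \<in> P" for p
  proof -
    from B[OF p] obtain B where "\<And>k. p (a k) \<le> B * M ^ k" by blast
    from this[of "Suc _"] have "p (c k) \<le> B * M * M ^ k" for k
      by (simp add: c_def seminorm_scale[OF p] norm_power mult_ac)
    then show ?thesis by blast
  qed
  have small: "\<exists>C. \<forall>k. p (scale (u ^ k) (b k)) \<le> C * (1 / 2) ^ k"
    if p: "p \<in> P" and b: "\<exists>B. \<forall>k. p (b k) \<le> B * M ^ k" and u: "cmod u < 1 / (8 * M)" for p b u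
  proof -
    from b obtain B where B: "\<And>k. p (b k) \<le> B * M ^ k" by blast
    have B0: "0 \<le> B" using B[of 0] seminorm_nonneg[OF p, of "b 0"] by simp
    have "p (scale (u ^ k) (b k)) \<le> B * (1 / 2) ^ k" for k
    proof -
      have "p (scale (u ^ k) (b k)) \<le> (1 / (8 * M)) ^ k * (B * M ^ k)"
        unfolding seminorm_scale[OF p] norm_power
        using B B0 M u seminorm_nonneg[OF p] by (intro mult_mono power_mono) auto
      also have "\<dots> = B * (1 / 8) ^ k" using M by (simp add: power_divide power_mult_distrib)
      also have "\<dots> \<le> B * (1 / 2) ^ k" using B0 by (intro mult_left_mono power_mono) auto
      finally show ?thesis .
    qed
    then show ?thesis by blast
  qed
  have "\<exists>s. (\<lambda>k. scale ((w - l) ^ k) (c k)) sums s" if "cmod (w - l) < 1 / (8 * M)" for w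
    using that by (intro sums_geometric small c)
  then obtain f where f: "\<And>w. cmod (w - l) < 1 / (8 * M) \<Longrightarrow> (\<lambda>k. scale ((w - l) ^ k) (c k)) sums f w"
    by metis
  have "scale w (f w) - T (f w) = x" if w: "cmod (w - l) < 1 / (8 * M)" for w
  proof -
    define v where "v k = scale ((l - w) ^ k) (a k)" for k
    have "cmod (l - w) < 1 / (8 * M)" using w by (simp add: norm_minus_commute)
    \<comment> \<open>Summability of \<open>v\<close> is established to obtain that its terms tend
      to 0, as telescoping requires.\<close>
    then have "\<exists>s. v sums s" unfolding v_def by (intro sums_geometric small B)
    then obtain s where s: "v sums s" by blast
    have "v \<longlonglongrightarrow> 0"
    proof -
      have "(\<lambda>n. (\<Sum>i<Suc n. v i) - (\<Sum>i<n. v i)) \<longlonglongrightarrow> s - s"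
        using s unfolding sums_def by (intro tendsto_diff LIMSEQ_Suc)
      then show ?thesis by simp
    qed
    then have "(\<lambda>k. v k - v (Suc k)) sums v 0" by (rule telescope_sums_group)
    moreover have "scale w (scale ((w - l) ^ k) (c k)) - T (scale ((w - l) ^ k) (c k)) = v k - v (Suc k)" for k
    proof -
      have pow: "(w - l) ^ k * (-1) ^ k = (l - w) ^ k"
        by (simp flip: power_mult_distrib)
      have "scale w (a (Suc k)) - T (a (Suc k)) = a k - scale (l - w) (a (Suc k))"
        using aSuc[of k] by (simp add: scale_left_diff_distrib algebra_simps)
      then have "scale ((l - w) ^ k) (scale w (a (Suc k)) - T (a (Suc k))) = v k - v (Suc k)"
        by (simp add: v_def scale_right_diff_distrib mult.commute)
      then show ?thesis
        by (simp only: c_def scale_scale pow quotient_bounded_scale[OF T] scale_right_diff_distrib mult.commute[of _ w])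
    qed
    moreover have "(\<lambda>k. scale w (scale ((w - l) ^ k) (c k)) - T (scale ((w - l) ^ k) (c k)))
        sums (scale w (f w) - T (f w))"
      by (intro sums_diff_group sums_quotient_bounded[OF quotient_bounded_scalar] sums_quotient_bounded[OF T] f w)
    ultimately have "scale w (f w) - T (f w) = v 0"
      unfolding sums_def by (simp add: LIMSEQ_unique)
    then show ?thesis by (simp add: v_def a0)
  qed
  moreover have "lc_analytic_on scale f (ball l (1 / (8 * M)))"
    using M c f by (rule power_series_lc_analytic)
  ultimately show ?thesis
    unfolding local_resolvent_set_def using M
    by (auto intro!: exI[of _ "ball l (1 / (8 * M))"] exI[of _ f] simp: dist_norm norm_minus_commute)
qed

section \<open>Transfer along quasi-nilpotent equivalence\<close>

text \<open>The binomial series of \<open>((l I - T) - (S - T))\<^sup>-\<^sup>m\<close>, with \<open>(S - T)\<^sup>[\<^sup>n\<^sup>]\<close> in place of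
  \<open>(S - T)\<^sup>n\<close>. For \<open>m = 0\<close> truncated subtraction gives the coefficients \<open>1, 0, 0, \<dots>\<close>.\<close>

lemma resolvent_sequence_transfer:
  assumes T: "T \<in> quotient_bounded scale P" and S: "S \<in> quotient_bounded scale P"
    and quasi: "\<And>p. p \<in> P \<Longrightarrow> (\<lambda>n. root n (op_seminorm p (bracket_power scale S T n))) \<longlonglongrightarrow> 0"
    and a: "resolvent_sequence T l x a"
  shows "\<exists>b. resolvent_sequence S l x b"
proof -
  obtain M where M: "M > 0" and B: "\<And>p. p \<in> P \<Longrightarrow> \<exists>B. \<forall>k. p (a k) \<le> B * M ^ k"
    using a unfolding resolvent_sequence_def by blast
  have a0: "a 0 = x" and aSuc: "\<And>k. scale l (a (Suc k)) - T (a (Suc k)) = a k"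
    using a unfolding resolvent_sequence_def by auto
  define A where "A = bracket_power scale S T"
  have A: "A n \<in> quotient_bounded scale P" for n
    unfolding A_def using S T by (rule bracket_power_quotient_bounded)
  have A_bound: "\<exists>C. \<forall>n m. p (A n (a (n + m))) \<le> C * M ^ m * (1 / 4) ^ n" if p: "p \<in> P" for p
  proof -
    from B[OF p] obtain B where B: "\<And>k. p (a k) \<le> B * M ^ k" by blast
    \<comment> \<open>The rate \<open>1 / (4 * M)\<close> cancels the growth of \<open>a\<close> and
      leaves \<open>(1 / 4) ^ n\<close>. Binomial coefficients then cost \<open>2 ^ (n + m)\<close>,
      which leaves \<open>(1 / 2) ^ n\<close> and raises the growth rate in \<open>m\<close> from
      \<open>M\<close> to \<open>2 * M\<close>.\<close>
    obtain K where K: "K \<ge> 0" "\<And>n. op_seminorm p (A n) \<le> K * (1 / (4 * M)) ^ n"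
      using geometric_bound_if_root_tendsto_0[of "\<lambda>n. op_seminorm p (A n)" "1 / (4 * M)"]
        op_seminorm_bound(1)[OF A p] quasi[OF p] M by (auto simp: A_def)
    have "p (A n (a (n + m))) \<le> K * B * M ^ m * (1 / 4) ^ n" for n m
    proof -
      have "p (A n (a (n + m))) \<le> op_seminorm p (A n) * p (a (n + m))"
        using A p by (rule op_seminorm_bound(2))
      also have "\<dots> \<le> K * (1 / (4 * M)) ^ n * (B * M ^ (n + m))"
        using K B M seminorm_nonneg[OF p] by (intro mult_mono) auto
      also have "\<dots> = K * B * M ^ m * (1 / 4) ^ n"
        using M by (simp add: power_add power_divide power_mult_distrib)
      finally show ?thesis .
    qed
    then show ?thesis by blast
  qed
  \<comment> \<open>Stated for general coefficients because it is used both for the series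
    \<open>t\<close> and for the telescoping terms \<open>v\<close>.\<close>
  have term_bound: "\<exists>C. \<forall>m n. p (scale (of_nat (f n m)) (A n (a (n + m)))) \<le> C * (2 * M) ^ m * (1 / 2) ^ n"
    if p: "p \<in> P" and f: "\<And>n m. f n m \<le> 2 ^ (n + m)" for p and f :: "nat \<Rightarrow> nat \<Rightarrow> nat"
  proof -
    from A_bound[OF p] obtain C where C: "\<And>n m. p (A n (a (n + m))) \<le> C * M ^ m * (1 / 4) ^ n" by blast
    have "p (scale (of_nat (f n m)) (A n (a (n + m)))) \<le> C * (2 * M) ^ m * (1 / 2) ^ n" for m n
    proof -
      have "real (f n m) \<le> 2 ^ (n + m)"
        using f[of n m] by (metis of_nat_le_iff of_nat_numeral of_nat_power)
      then have "p (scale (of_nat (f n m)) (A n (a (n + m)))) \<le> 2 ^ (n + m) * (C * M ^ m * (1 / 4) ^ n)"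
        unfolding seminorm_scale[OF p] norm_of_nat
        using C seminorm_nonneg[OF p] by (intro mult_mono) auto
      also have "\<dots> = C * (2 * M) ^ m * (2 * (1 / 4)) ^ n"
        by (simp only: power_add power_mult_distrib mult_ac)
      finally show ?thesis by simp
    qed
    then show ?thesis by blast
  qed
  define t where "t m n = scale (of_nat ((n + m - 1) choose n)) (A n (a (n + m)))" for m n
  have t_bound: "\<exists>C. \<forall>m n. p (t m n) \<le> C * (2 * M) ^ m * (1 / 2) ^ n" if p: "p \<in> P" for p
    unfolding t_def
  proof (rule term_bound[OF p])
    show "(n + m - 1) choose n \<le> 2 ^ (n + m)" for n m
      by (rule order_trans[OF binomial_le_pow2]) (simp add: power_increasing)
  qed
  have "\<exists>s. t m sums s" for m
    using t_bound by (intro sums_geometric) blast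
  then obtain b where b: "\<And>m. t m sums b m" by metis
  have "b 0 = x"
  proof -
    have "t 0 = (\<lambda>n. if n = 0 then x else 0)"
    proof
      show "t 0 n = (if n = 0 then x else 0)" for n
        by (cases n) (auto simp: t_def A_def a0)
    qed
    then have "t 0 sums x" using sums_single[of 0 "\<lambda>_. x"] by simp
    with b[of 0] show ?thesis unfolding sums_def by (rule LIMSEQ_unique)
  qed
  moreover have "scale l (b (Suc m)) - S (b (Suc m)) = b m" for m
  proof -
    \<comment> \<open>By \<open>bracket_power_Suc\<close>, moving l I - S past \<open>A n\<close>
      yields l I - T on the right, which lowers the index of \<open>a\<close>, at the price of a
      term with \<open>A (Suc n)\<close>.\<close>
    have A_step: "scale l (A n (a (Suc k))) - S (A n (a (Suc k))) = A n (a k) - A (Suc n) (a (Suc k))" for n k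
    proof -
      have "A n (a k) = scale l (A n (a (Suc k))) - A n (T (a (Suc k)))"
        by (metis A aSuc quotient_bounded_diff quotient_bounded_scale)
      then show ?thesis
        using bracket_power_Suc[OF S, of T n "a (Suc k)"] by (simp add: A_def)
    qed
    \<comment> \<open>The second summand in Pascal's rule. It is set to 0 at \<open>n = 0\<close>,
      where truncation of \<open>n - 1\<close> would give 1. As \<open>e (Suc n) m\<close> is
      \<open>(n + m) choose n\<close>, the term with \<open>A (Suc n)\<close> is exactly
      \<open>v (Suc n)\<close>, so everything but \<open>t m n\<close> telescopes.\<close>
    define e where "e n m = (if n = 0 then 0 else (n + m - 1) choose (n - 1))" for n m :: nat
    define v where "v n = scale (of_nat (e n m)) (A n (a (n + m)))" for n
    have Pascal: "(n + m) choose n = ((n + m - 1) choose n) + e n m" for n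
      by (cases n; cases m) (auto simp: e_def)
    have step: "scale l (t (Suc m) n) - S (t (Suc m) n) = t m n + (v n - v (Suc n))" for n
    proof -
      have "scale l (t (Suc m) n) - S (t (Suc m) n)
          = scale (of_nat ((n + m) choose n)) (A n (a (n + m)) - A (Suc n) (a (Suc (n + m))))"
        unfolding A_step[symmetric] t_def
        by (simp add: quotient_bounded_scale[OF S] scale_right_diff_distrib mult.commute)
      also have "\<dots> = t m n + v n - scale (of_nat ((n + m) choose n)) (A (Suc n) (a (Suc (n + m))))"
        unfolding scale_right_diff_distrib
        by (subst (1) Pascal) (simp add: t_def v_def scale_left_distrib)
      also have "\<dots> = t m n + (v n - v (Suc n))" by (simp add: v_def e_def)
      finally show ?thesis .
    qed
    have "v \<longlonglongrightarrow> 0"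
      unfolding tendsto_iff_seminorms
    proof
      fix p assume p: "p \<in> P"
      have "e n m \<le> 2 ^ (n + m)" for n m
        unfolding e_def by (cases n) (auto intro: order_trans[OF binomial_le_pow2])
      then obtain C where C: "\<And>n. p (v n) \<le> C * (2 * M) ^ m * (1 / 2) ^ n"
        using term_bound[OF p, of e] unfolding v_def by blast
      have lim: "(\<lambda>n. C * (2 * M) ^ m * (1 / 2) ^ n) \<longlonglongrightarrow> 0"
        by (intro tendsto_mult_right_zero LIMSEQ_power_zero) simp
      show "(\<lambda>n. p (v n - 0)) \<longlonglongrightarrow> 0"
        by (rule Lim_null_comparison[OF _ lim]) (use C seminorm_nonneg[OF p] in auto)
    qed
    then have "(\<lambda>n. t m n + (v n - v (Suc n))) sums (b m + v 0)"
      by (intro sums_add_group b telescope_sums_group)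
    moreover have "(\<lambda>n. scale l (t (Suc m) n) - S (t (Suc m) n)) sums (scale l (b (Suc m)) - S (b (Suc m)))"
      by (intro sums_diff_group sums_quotient_bounded[OF quotient_bounded_scalar] sums_quotient_bounded[OF S] b)
    moreover have "v 0 = 0" by (simp add: v_def e_def)
    ultimately show ?thesis
      unfolding step sums_def by (simp add: LIMSEQ_unique)
  qed
  moreover have "\<exists>B. \<forall>m. p (b m) \<le> B * (2 * M) ^ m" if p: "p \<in> P" for p
  proof -
    from t_bound[OF p] obtain C where C: "\<And>m n. p (t m n) \<le> C * (2 * M) ^ m * (1 / 2) ^ n" by blast
    have "p (b m) \<le> 2 * (C * (2 * M) ^ m)" for m
      using b p C by (rule sums_seminorm_le)
    then show ?thesis by (intro exI[of _ "2 * C"]) (simp add: mult.assoc)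
  qed
  moreover have "2 * M > 0" using M by simp
  ultimately have "resolvent_sequence S l x b"
    unfolding resolvent_sequence_def by blast
  then show ?thesis by blast
qed

text \<open>Each of the two limits in quasi-nilpotent equivalence gives one inclusion; equality
  follows by exchanging \<open>T\<close> and \<open>S\<close>.\<close>

lemma local_resolvent_set_mono:
  assumes "T \<in> quotient_bounded scale P" "S \<in> quotient_bounded scale P"
    and "\<And>p. p \<in> P \<Longrightarrow> (\<lambda>n. root n (op_seminorm p (bracket_power scale S T n))) \<longlonglongrightarrow> 0"
  shows "local_resolvent_set scale T x \<subseteq> local_resolvent_set scale S x"
  using assms local_resolvent_imp_sequence resolvent_sequence_transfer sequence_imp_local_resolvent
  by blast

end

theorem theorem3p11:
  fixes scale :: "complex \<Rightarrow> 'a::{topological_ab_group_add, t2_space} \<Rightarrow> 'a"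
    and P :: "('a \<Rightarrow> real) set"
    and T S :: "'a \<Rightarrow> 'a"
  assumes "locally_convex_space scale"
    and "sequentially_complete TYPE('a)"
    and "calibration scale P"
    and "T \<in> bounded_elements scale P"
    and "S \<in> bounded_elements scale P"
    and "quasinilpotent_equivalent scale P T S"
    and "SVEP scale T"
  shows "\<forall>x. local_spectrum scale T x = local_spectrum scale S x"
proof
  fix x
  interpret complete_calibrated_space scale P
    using assms(1-3) by (simp add: complete_calibrated_space_def complete_calibrated_space_axioms_def
        complex_vector_space_def locally_convex_space_def)
  have "T \<in> quotient_bounded scale P" "S \<in> quotient_bounded scale P"
    using assms(4,5) by (auto simp: bounded_elements_def)
  then have "local_resolvent_set scale T x = local_resolvent_set scale S x"
    using assms(6) unfolding quasinilpotent_equivalent_def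
    by (intro equalityI local_resolvent_set_mono) auto
  then show "local_spectrum scale T x = local_spectrum scale S x"
    by (simp add: local_spectrum_def)
qed

end
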